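(* Let $\kappa$ be an infinite cardinal and let $X$ be a regular initially $\kappa$-compact space with $\pi\chi(X)=\kappa$ and no free sequences of length $\kappa^+$ (that is, $\mathcal F(X)\le\kappa$). Then any Shapirovskii $\pi$-base for $X$ is point-$\kappa$.
   Context: Regular spaces are assumed $T_1$. $X$ is initially $\kappa$-compact if every open cover of $X$ of cardinality at most $\kappa$ has a finite subcover. A sequence $\{p_\alpha:\alpha<\mu\}\subseteq X$ is free if $\overline{\{p_\alpha:\alpha<\delta\}}\cap\overline{\{p_\alpha:\delta\le\alpha<\mu\}}=\emptyset$ for every $\delta<\mu$; $\mathcal F(X)$ is the supremum of cardinalities of free sequences in $X$. A family $\mathcal R$ of subsets of $X$ is point-$\kappa$ if every point of $X$ belongs to at most $\kappa$ members of $\mathcal R$. $\mathcal T_X$ is the family of all nonempty open subsets of $X$. A family $\mathcal R\subseteq\mathcal T_X$ is a local $\pi$-base for $p\in X$ if every open $U\ni p$ contains some $R\in\mathcal R$; $\pi\chi(p,X)$ is the least cardinality of a local $\pi$-base for $p$, and $\pi\chi(X)=\sup\{\pi\chi(p,X):p\in X\}$. $d(X)$ is the least cardinality of a dense subset. For $P=\{p_\alpha:\alpha<\mu\}$ and $\delta\le\mu$ write $P_\delta=\{p_\alpha:\alpha<\delta\}$ and $P^\delta=\{p_\alpha:\delta\le\alpha<\mu\}$. $P$ is left-separated (as written) if $\overline{P_\delta}\cap P^\delta=\emptyset$ for every $\delta<\mu$. The function $\gamma_\kappa$. Let $\sigma=\sigma_\kappa$ be the class function on ordinals with $\sigma(0)=0$,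 $\sigma(1)=\kappa$, $\sigma(\alpha+1)=\sigma(\alpha)+|\sigma(\alpha)|$ for $\alpha>0$, and $\sigma(\beta)=\sup_{\alpha<\beta}\sigma(\alpha)$ for limit $\beta$ (ordinal sums). Every ordinal $\delta$ is uniquely of the form $\delta=\sigma(\alpha_0)+\dots+\sigma(\alpha_{n-1})+\Delta$ with $n\in\omega$, $|\sigma(\alpha_0)|>\dots>|\sigma(\alpha_{n-1})|$, $\alpha_{n-1}>0$, $\Delta<\kappa$. Put $\gamma_\kappa(\delta)=0$ if $n=0$ and $\gamma_\kappa(\delta)=\sigma(\alpha_0)+\dots+\sigma(\alpha_{n-2})$ otherwise (so it is $0$ if $n=1$). Shapirovskii $\pi$-base. Let $X$ be regular with $\pi\chi(X)=\kappa$ infinite and $\lambda=d(X)$ infinite. A Shapirovskii $\pi$-base for $X$ is an indexed family $\mathcal S=\{S_{\alpha,i}:\langle\alpha,i\rangle\in\lambda\times\kappa\}\subseteq\mathcal T_X$ together with a dense subspace $P=\{p_\alpha:\alpha<\lambda\}$ of $X$, left-separated as written, such that: (a) for each $\alpha<\lambda$, $\{S_{\alpha,i}:i<\kappa\}$ is a local $\pi$-base for $p_\alpha$ in $X$; (b) for each $\alpha<\lambda$, $\overline{P_\alpha}\cap\bigcup\{\overline{S_{\beta,i}}:\alpha\le\beta<\lambda,\ i<\kappa\}=\emptyset$; (c) for every ordinal $\delta$ with $0<\delta\le\lambda$ of the form $\delta=\kappa\cdot\epsilon$ (ordinal product) and every finite $A\subseteq[\gamma_\kappa(\delta),\delta)\times\kappa$,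 if $\bigcap_{a\in A}\overline{S_a}\ne\emptyset$ then $\bigcap_{a\in A}\overline{S_a}\cap\bigcup\{\overline{P_\alpha}:\alpha<\delta\}\neq\emptyset$ (hence $\bigcap_{a\in A}\overline{S_a}\cap\overline{P_\delta}\ne\emptyset$). Here the intersection of the empty family is $X$. *)

theory Defs
  imports "HOL-Analysis.Analysis" "HOL-Library.Equipollence"
begin

section \<open>Ordinals\<close>

text \<open>
  The type \<open>'a ordinal\<close> consists of the order types of all well-orders whose field is a set of
  elements of \<open>nat + 'a\<close>, i.e. of the ordinals below \<open>\<theta>\<^sup>+\<close> where \<open>\<theta>\<close> is the cardinality of
  \<open>nat + 'a\<close>. The summand \<open>nat\<close> makes \<open>\<theta>\<close> infinite, so that these ordinals are closed under
  suprema of at most \<open>\<theta>\<close> many ordinals, under ordinal sums and products, and under cardinality.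
\<close>

quotient_type 'a ordinal = "(nat + 'a) rel" / partial: "\<lambda>r s. (r, s) \<in> ordIso"
  morphisms rep_ordinal order_type
proof (rule part_equivpI)
  show "\<exists>r :: (nat + 'a) rel. (r, r) \<in> ordIso"
    using card_of_Well_order ordIso_reflexive by blast
  show "symp (\<lambda>r s :: (nat + 'a) rel. (r, s) \<in> ordIso)"
    by (simp add: sympI ordIso_symmetric)
  show "transp (\<lambda>r s :: (nat + 'a) rel. (r, s) \<in> ordIso)"
    by (meson transpI ordIso_transitive)
qed

instantiation ordinal :: (type) wellorder
begin

lift_definition less_eq_ordinal :: "'a ordinal \<Rightarrow> 'a ordinal \<Rightarrow> bool" is "\<lambda>r s. (r, s) \<in> ordLeq"
  by (meson ordIso_ordLeq_trans ordIso_symmetric ordLeq_ordIso_trans)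

lift_definition less_ordinal :: "'a ordinal \<Rightarrow> 'a ordinal \<Rightarrow> bool" is "\<lambda>r s. (r, s) \<in> ordLess"
  by (meson ordIso_ordLess_trans ordIso_symmetric ordLess_ordIso_trans)

instance
proof
  fix x y z :: "'a ordinal"
  show "x < y \<longleftrightarrow> x \<le> y \<and> \<not> y \<le> x"
    by transfer (metis not_ordLess_ordLeq ordLess_imp_ordLeq not_ordLeq_iff_ordLess
        ordLeq_Well_order_simp)
  show "x \<le> x"
    by transfer (simp add: ordIso_iff_ordLeq)
  show "x \<le> y \<Longrightarrow> y \<le> z \<Longrightarrow> x \<le> z"
    by transfer (rule ordLeq_transitive)
  show "x \<le> y \<Longrightarrow> y \<le> x \<Longrightarrow> x = y"
    by transfer (simp add: ordIso_iff_ordLeq)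
  show "x \<le> y \<or> y \<le> x"
    by transfer (meson ordIso_imp_ordLeq ordLeq_Well_order_simp ordLeq_total)
next
  fix P :: "'a ordinal \<Rightarrow> bool" and a
  assume step: "\<And>x. (\<And>y. y < x \<Longrightarrow> P y) \<Longrightarrow> P x"
  have "wf (inv_image (ordLess :: ((nat + 'a) rel \<times> (nat + 'a) rel) set) rep_ordinal)"
    by (rule wf_inv_image) (rule wf_ordLess)
  moreover have "(y, x) \<in> inv_image ordLess rep_ordinal" if "y < x" for x y :: "'a ordinal"
    using that by (simp add: less_ordinal_def)
  ultimately show "P a"
    using step by (induction a rule: wf_induct_rule) blast
qed

end

text \<open>
  Every well-order is isomorphic to the segment of ordinals below its order type, and any set of at
  most \<open>\<theta>\<close> ordinals is strictly bounded (Burali-Forti). In particular the \<open>LEAST\<close>s below are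
  attained.
\<close>

lemma ordinal_cases:
  fixes x :: "'a ordinal"
  obtains r where "Well_order r" "x = order_type r"
proof -
  have "(rep_ordinal x, rep_ordinal x) \<in> ordIso" "x = order_type (rep_ordinal x)"
    by (rule Quotient_rep_reflp[OF Quotient_ordinal])
      (rule Quotient_abs_rep[OF Quotient_ordinal, symmetric])
  then show thesis
    using that ordIso_imp_ordLeq ordLeq_Well_order_simp by blast
qed

lemma order_type_less_iff:
  assumes "Well_order r" "Well_order s"
  shows "order_type r < order_type s \<longleftrightarrow> (r, s) \<in> ordLess"
  using assms by (simp add: less_ordinal.abs_eq ordIso_reflexive)

lemma order_type_eq_iff:
  assumes "Well_order r" "Well_order s"
  shows "order_type r = order_type s \<longleftrightarrow> (r, s) \<in> ordIso"
  using Quotient_rel[OF Quotient_ordinal, of r s] assms[THEN ordIso_reflexive] by simp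

definition ordinal_le :: "'a ordinal set \<Rightarrow> 'a ordinal rel" where
  "ordinal_le A = {(x, y). x \<in> A \<and> y \<in> A \<and> x \<le> y}"

lemma Field_ordinal_le [simp]: "Field (ordinal_le A) = A"
  by (auto simp: ordinal_le_def Field_def)

lemma well_order_on_ordinal_le [simp]: "well_order_on A (ordinal_le A)"
proof -
  have "ordinal_le A - Id \<subseteq> {(x, y). x < y}"
    by (auto simp: ordinal_le_def)
  then have "wf (ordinal_le A - Id)"
    using wf wf_subset by blast
  moreover have "refl_on A (ordinal_le A)" "trans (ordinal_le A)" "antisym (ordinal_le A)"
    "total_on A (ordinal_le A)"
    by (auto simp: ordinal_le_def refl_on_def trans_def antisym_def total_on_def)
  moreover have "ordinal_le A \<subseteq> A \<times> A"
    by (auto simp: ordinal_le_def)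
  ultimately show ?thesis
    by (simp add: well_order_on_def linear_order_on_def partial_order_on_def preorder_on_def)
qed

lemma Well_order_ordinal_le: "Well_order (ordinal_le A)"
  by simp

lemma ordIso_segment:
  fixes r :: "(nat + 'a) rel"
  assumes r: "Well_order r"
  shows "(r, ordinal_le {..<order_type r}) \<in> ordIso"
proof -
  interpret wo_rel r by (simp add: wo_rel_def r)
  define g where "g a = order_type (Restr r (underS a))" for a
  have mono: "g a < g b" if "(a, b) \<in> r" "a \<noteq> b" for a b
  proof -
    have "underS a \<subset> underS b"
      using that TRANS ANTISYM unfolding underS_def trans_def antisym_def by blast
    then have "(Restr r (underS a), Restr r (underS b)) \<in> ordLess"
      using ofilter_subset_ordLess[OF r underS_ofilter underS_ofilter] by blast
    then show ?thesis
      by (simp add: g_def order_type_less_iff Well_order_Restr r)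
  qed
  have "inj_on g (Field r)"
    by (rule inj_onI) (metis TOTALS less_irrefl mono)
  moreover have "g ` Field r = {..<order_type r}"
  proof safe
    fix a assume "a \<in> Field r"
    then have "(Restr r (underS a), r) \<in> ordLess"
      using underS_Restr_ordLess[OF r] by blast
    then show "g a < order_type r"
      by (simp add: g_def order_type_less_iff Well_order_Restr r)
  next
    fix y assume y: "y < order_type r"
    obtain s where s: "Well_order s" "y = order_type s"
      by (rule ordinal_cases)
    with y have "(s, r) \<in> ordLess"
      by (simp add: order_type_less_iff r)
    then obtain a where "a \<in> Field r" "(s, Restr r (underS a)) \<in> ordIso"
      using ordLess_iff_ordIso_Restr[OF r s(1)] by blast
    then show "y \<in> g ` Field r"
      by (auto simp: s(2) g_def order_type_eq_iff s(1) Well_order_Restr r)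
  qed
  ultimately have "bij_betw g (Field r) (Field (ordinal_le {..<order_type r}))"
    by (simp add: bij_betw_def)
  moreover have "compat r (ordinal_le {..<order_type r}) g"
  proof -
    have "g a \<le> g b" if "(a, b) \<in> r" for a b
      using mono[OF that] by (cases "a = b") auto
    then show ?thesis
      using \<open>g ` Field r = _\<close> by (fastforce simp: compat_def ordinal_le_def intro: FieldI1 FieldI2)
  qed
  ultimately show ?thesis
    unfolding ordIso_def using iso_iff3[OF r Well_order_ordinal_le] r by auto
qed

lemma ordIso_imp_eqpoll_Field: "(r, s) \<in> ordIso \<Longrightarrow> Field r \<approx> Field s"
  by (auto simp: ordIso_def iso_def eqpoll_def)

lemma lessThan_lepoll: "{..<x :: 'a ordinal} \<lesssim> (UNIV :: (nat + 'a) set)"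
proof -
  obtain r where r: "Well_order r" "x = order_type r"
    by (rule ordinal_cases)
  then have "Field r \<approx> {..<x}"
    using ordIso_imp_eqpoll_Field[OF ordIso_segment[OF r(1)]] by simp
  then show ?thesis
    by (rule lepoll_trans1[OF eqpoll_sym]) (simp add: subset_imp_lepoll)
qed

lemma UNIV_ordinal_not_lepoll: "\<not> (UNIV :: 'a ordinal set) \<lesssim> (UNIV :: (nat + 'a) set)"
proof
  assume "(UNIV :: 'a ordinal set) \<lesssim> (UNIV :: (nat + 'a) set)"
  then obtain f :: "'a ordinal \<Rightarrow> nat + 'a" where f: "inj f"
    by (auto simp: lepoll_def)
  let ?R = "ordinal_le (UNIV :: 'a ordinal set)"
  define r where "r = dir_image ?R f"
  have r: "Well_order r" "(?R, r) \<in> ordIso"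
    unfolding r_def using f by (auto intro!: Well_order_dir_image dir_image_ordIso)
  have "ordinal_le {..<x} = Restr ?R (underS ?R x)" for x :: "'a ordinal"
    by (auto simp: ordinal_le_def underS_def)
  then have "(ordinal_le {..<order_type r}, ?R) \<in> ordLess"
    using underS_Restr_ordLess[OF Well_order_ordinal_le[of "UNIV :: 'a ordinal set"]] by simp
  moreover have "(?R, ordinal_le {..<order_type r}) \<in> ordIso"
    by (rule ordIso_transitive[OF r(2) ordIso_segment[OF r(1)]])
  ultimately show False
    using not_ordLess_ordIso ordIso_symmetric by blast
qed

lemma infinite_nat_plus: "infinite (UNIV :: (nat + 'a) set)"
  by simp

lemma lepoll_iff_ordLeq: "A \<lesssim> B \<longleftrightarrow> (card_of A, card_of B) \<in> ordLeq"
  by (simp only: lepoll_def card_of_ordLeq)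

lemma ordinal_strict_bound:
  fixes A :: "'a ordinal set"
  assumes "A \<lesssim> (UNIV :: (nat + 'a) set)"
  shows "\<exists>y. \<forall>x\<in>A. x < y"
proof (rule ccontr)
  assume "\<not> ?thesis"
  then have cover: "(\<Union>x\<in>A. {..x}) = UNIV"
    by (auto simp: not_less)
  have "(card_of {..x}, card_of (UNIV :: (nat + 'a) set)) \<in> ordLeq" for x :: "'a ordinal"
  proof -
    have "insert x {..<x} \<lesssim> (UNIV :: (nat + 'a) set)"
    proof (cases "finite {..<x}")
      case False
      then show ?thesis
        by (rule lepoll_trans[OF infinite_insert_lepoll lessThan_lepoll])
    qed (simp add: finite_lepoll_infinite infinite_nat_plus)
    moreover have "insert x {..<x} = {..x}"
      by auto
    ultimately show ?thesis
      by (simp only: lepoll_iff_ordLeq)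
  qed
  moreover have "(card_of A, card_of (UNIV :: (nat + 'a) set)) \<in> ordLeq"
    using assms by (simp only: lepoll_iff_ordLeq)
  ultimately have "(card_of (\<Union>x\<in>A. {..x}), card_of (UNIV :: (nat + 'a) set)) \<in> ordLeq"
    by (intro card_of_UNION_ordLeq_infinite) (auto simp: infinite_nat_plus)
  then have "(UNIV :: 'a ordinal set) \<lesssim> (UNIV :: (nat + 'a) set)"
    by (simp only: lepoll_iff_ordLeq cover)
  with UNIV_ordinal_not_lepoll show False
    by (rule notE)
qed

lemma ex_ordinal_eqpoll:
  fixes A :: "'b set"
  assumes "A \<lesssim> (UNIV :: (nat + 'a) set)"
  shows "\<exists>x :: 'a ordinal. A \<approx> {..<x}"
proof -
  obtain f :: "'b \<Rightarrow> nat + 'a" where f: "inj_on f A"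
    using assms by (auto simp: lepoll_def)
  let ?r = "card_of (f ` A)"
  have "f ` A \<approx> {..<order_type ?r}"
    using ordIso_imp_eqpoll_Field[OF ordIso_segment[OF card_of_Well_order[of "f ` A"]]]
    by (simp add: Field_card_of)
  then have "A \<approx> {..<order_type ?r}"
    using f by simp
  then show ?thesis by blast
qed


instantiation ordinal :: (type) conditionally_complete_linorder
begin

definition inf_ordinal :: "'a ordinal \<Rightarrow> 'a ordinal \<Rightarrow> 'a ordinal" where
  "inf_ordinal = min"

definition sup_ordinal :: "'a ordinal \<Rightarrow> 'a ordinal \<Rightarrow> 'a ordinal" where
  "sup_ordinal = max"

definition Inf_ordinal :: "'a ordinal set \<Rightarrow> 'a ordinal" where
  "Inf_ordinal A = (LEAST x. x \<in> A)"

definition Sup_ordinal :: "'a ordinal set \<Rightarrow> 'a ordinal" where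
  "Sup_ordinal A = (LEAST x. \<forall>y\<in>A. y \<le> x)"

instance
proof
  fix x z :: "'a ordinal" and A :: "'a ordinal set"
  show "x \<in> A \<Longrightarrow> Inf A \<le> x"
    unfolding Inf_ordinal_def by (rule Least_le)
  show "z \<le> Inf A" if nonempty: "A \<noteq> {}" and lower: "\<And>x. x \<in> A \<Longrightarrow> z \<le> x"
  proof -
    obtain x where "x \<in> A"
      using nonempty by blast
    then have "Inf A \<in> A"
      unfolding Inf_ordinal_def by (rule LeastI)
    then show ?thesis
      by (rule lower)
  qed
  show "x \<le> Sup A" if x: "x \<in> A" and bdd: "bdd_above A"
  proof -
    obtain b where "\<forall>y\<in>A. y \<le> b"
      using bdd by (auto simp: bdd_above_def)
    then have "\<forall>y\<in>A. y \<le> Sup A"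
      unfolding Sup_ordinal_def by (rule LeastI)
    with x show ?thesis by blast
  qed
  show "(\<And>x. x \<in> A \<Longrightarrow> x \<le> z) \<Longrightarrow> Sup A \<le> z"
    unfolding Sup_ordinal_def by (simp add: Least_le)
qed (simp_all add: inf_ordinal_def sup_ordinal_def)

end

definition osuc :: "'a ordinal \<Rightarrow> 'a ordinal" where
  "osuc x = (LEAST y. x < y)"

definition is_limit :: "'a ordinal \<Rightarrow> bool" where
  "is_limit x \<longleftrightarrow> (\<exists>y. y < x) \<and> (\<nexists>y. x = osuc y)"

lemma less_osuc_iff [simp]: "x < osuc y \<longleftrightarrow> x \<le> y"
proof -
  have "\<exists>z. \<forall>x\<in>{y}. x < z"
    by (intro ordinal_strict_bound finite_lepoll_infinite) (auto simp: infinite_nat_plus)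
  then have "y < osuc y"
    unfolding osuc_def by (auto intro: LeastI)
  moreover have "\<not> (y < x \<and> x < osuc y)"
    unfolding osuc_def using not_less_Least by blast
  ultimately show ?thesis
    by (meson not_le order_le_less_trans)
qed

lemma osuc_inject [simp]: "osuc x = osuc y \<longleftrightarrow> x = y"
  by (metis less_osuc_iff order.antisym order.refl)

lemma bdd_above_image_lessThan [simp]: "bdd_above (f ` {..<x :: 'a ordinal} :: 'a ordinal set)"
proof -
  have "\<exists>y. \<forall>z\<in>f ` {..<x}. z < y"
    by (rule ordinal_strict_bound) (meson image_lepoll lepoll_trans lessThan_lepoll)
  then show ?thesis
    by (auto simp: bdd_above_def intro: less_imp_le)
qed

instantiation ordinal :: (type) "{zero, one, plus, times}"
begin

definition zero_ordinal :: "'a ordinal" where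
  "0 = (LEAST x :: 'a ordinal. True)"

definition one_ordinal :: "'a ordinal" where
  "1 = osuc (0 :: 'a ordinal)"

function plus_ordinal :: "'a ordinal \<Rightarrow> 'a ordinal \<Rightarrow> 'a ordinal" where
  "plus_ordinal x y = (if y = 0 then x else SUP z\<in>{..<y}. osuc (plus_ordinal x z))"
  by auto
termination
  by (relation "inv_image {(x, y). x < y} snd") (auto simp: wf)

function times_ordinal :: "'a ordinal \<Rightarrow> 'a ordinal \<Rightarrow> 'a ordinal" where
  "times_ordinal x y = (if y = 0 then 0 else SUP z\<in>{..<y}. times_ordinal x z + x)"
  by auto
termination
  by (relation "inv_image {(x, y). x < y} snd") (auto simp: wf)

instance ..

end

declare plus_ordinal.simps [simp del] times_ordinal.simps [simp del]

lemma ordinal_zero_le [simp]: "0 \<le> (x :: 'a ordinal)"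
  unfolding zero_ordinal_def by (simp add: Least_le)

lemma ordinal_not_less_zero [simp]: "\<not> (x :: 'a ordinal) < 0"
  by (simp add: not_less)

lemma ordinal_zero_less_iff: "0 < (x :: 'a ordinal) \<longleftrightarrow> x \<noteq> 0"
  by (simp add: order_less_le)

lemma less_plus_iff:
  fixes x y z :: "'a ordinal"
  shows "z < x + y \<longleftrightarrow> z < x \<or> (\<exists>w<y. z \<le> x + w)"
proof (cases "y = 0")
  case True
  then show ?thesis by (simp add: plus_ordinal.simps)
next
  case False
  then have "{..<y} \<noteq> {}"
    by (metis ordinal_zero_less_iff empty_iff lessThan_iff)
  then have *: "z < x + y \<longleftrightarrow> (\<exists>w<y. z \<le> x + w)"
    using False by (subst plus_ordinal.simps) (simp add: less_cSup_iff, blast)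
  moreover have "z \<le> x + 0" if "z < x"
    using that by (simp add: plus_ordinal.simps)
  ultimately show ?thesis
    using False ordinal_zero_less_iff by blast
qed

lemma plus_less_cancel_left: "(x :: 'a ordinal) + y < x + z \<longleftrightarrow> y < z"
proof
  have mono: "x + y < x + z" if "y < z" for y z
    using that less_plus_iff by blast
  show "x + y < x + z" if "y < z"
    using mono that .
  show "y < z" if "x + y < x + z"
    using that mono[of z y] by (cases y z rule: linorder_cases) auto
qed

instance ordinal :: (type) monoid_add
proof
  fix a b c :: "'a ordinal"
  show right: "a + 0 = a" for a :: "'a ordinal"
    by (simp add: plus_ordinal.simps)
  have eqI: "x = y" if "\<And>z. z < x \<longleftrightarrow> z < y" for x y :: "'a ordinal"
    using that[of x] that[of y] by (cases x y rule: linorder_cases) auto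
  show "0 + a = a"
  proof (induction a rule: less_induct)
    case (less a)
    have "z < 0 + a \<longleftrightarrow> (\<exists>w<a. z \<le> w)" for z
      using less by (auto simp: less_plus_iff[of z 0 a])
    then show ?case
      by (intro eqI) (meson order.refl order_le_less_trans)
  qed
  show "(a + b) + c = a + (b + c)"
  proof (induction c rule: less_induct)
    case (less c)
    show ?case
    proof (rule eqI)
      fix z
      have "(\<exists>w<b + c. z \<le> a + w) \<longleftrightarrow> (\<exists>w<b. z \<le> a + w) \<or> (\<exists>u<c. z \<le> a + (b + u))" (is "?l \<longleftrightarrow> ?r")
      proof
        assume ?l
        then obtain w where w: "w < b + c" "z \<le> a + w"
          by blast
        from w(1) consider "w < b" | u where "u < c" "w \<le> b + u"
          unfolding less_plus_iff[of w b c] by blast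
        then show ?r
        proof cases
          case 2
          then have "a + w \<le> a + (b + u)"
            using plus_less_cancel_left[of a "b + u" w] by (simp add: not_less[symmetric])
          with w(2) have "z \<le> a + (b + u)"
            by (rule order_trans)
          with 2 show ?thesis by blast
        qed (use w in blast)
      next
        assume ?r
        moreover have "w < b + c" if "w < b" for w
          using that less_plus_iff[of w b c] by blast
        moreover have "b + u < b + c" if "u < c" for u
          using that by (simp add: plus_less_cancel_left)
        ultimately show ?l by blast
      qed
      then have "z < a + (b + c) \<longleftrightarrow> z < a + b \<or> (\<exists>u<c. z \<le> a + (b + u))"
        using less_plus_iff[of z a "b + c"] less_plus_iff[of z a b] by argo
      moreover have "z < (a + b) + c \<longleftrightarrow> z < a + b \<or> (\<exists>u<c. z \<le> (a + b) + u)"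
        by (rule less_plus_iff)
      moreover have "(\<exists>u<c. z \<le> (a + b) + u) \<longleftrightarrow> (\<exists>u<c. z \<le> a + (b + u))"
        using less by metis
      ultimately show "z < (a + b) + c \<longleftrightarrow> z < a + (b + c)"
        by argo
    qed
  qed
qed


section \<open>Cardinals\<close>

text \<open>As usual, cardinals are the initial ordinals.\<close>

definition ocard :: "'b set \<Rightarrow> 'a ordinal" where
  "ocard A = (LEAST x. A \<approx> {..<x})"

definition is_cardinal :: "'a ordinal \<Rightarrow> bool" where
  "is_cardinal x \<longleftrightarrow> ocard {..<x} = x"

definition infinite_cardinal :: "'a ordinal \<Rightarrow> bool" where
  "infinite_cardinal \<kappa> \<longleftrightarrow> is_cardinal \<kappa> \<and> infinite {..<\<kappa>}"

definition cardinal_succ :: "'a ordinal \<Rightarrow> 'a ordinal" where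
  "cardinal_succ x = (LEAST y. is_cardinal y \<and> x < y)"


section \<open>The functions \<open>\<sigma>\<close> and \<open>\<gamma>\<close>\<close>

function sigma :: "'a ordinal \<Rightarrow> 'a ordinal \<Rightarrow> 'a ordinal" where
  "sigma \<kappa> x =
    (if x = 0 then 0
     else if x = 1 then \<kappa>
     else if is_limit x then SUP y\<in>{..<x}. sigma \<kappa> y
     else let y = (THE y. x = osuc y) in sigma \<kappa> y + ocard {..<sigma \<kappa> y})"
  by auto
termination
proof (relation "inv_image {(x, y). x < y} snd")
  fix x :: "'a ordinal"
  assume "x \<noteq> 0" "\<not> is_limit x"
  then obtain y where "x = osuc y"
    using ordinal_zero_less_iff is_limit_def by blast
  then have "(THE y. x = osuc y) < x"
    by simp
  then show "\<And>\<kappa> y. y = (THE y. x = osuc y) \<Longrightarrow>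
      ((\<kappa>, y), \<kappa>, x) \<in> inv_image {(x, y). x < y} snd"
    by simp
  then show "\<And>\<kappa> y. y = (THE y. x = osuc y) \<Longrightarrow>
      ((\<kappa>, y), \<kappa>, x) \<in> inv_image {(x, y). x < y} snd"
    by simp
qed (auto simp: wf)

declare sigma.simps [simp del]

lemma osuc_neq_0 [simp]: "osuc x \<noteq> 0"
proof
  assume "osuc x = 0"
  moreover have "x < osuc x" by simp
  ultimately show False by simp
qed

lemma sigma_0: "sigma \<kappa> 0 = 0"
  by (simp add: sigma.simps)

lemma sigma_1: "sigma \<kappa> 1 = \<kappa>"
  by (subst sigma.simps) (simp add: one_ordinal_def)

lemma sigma_osuc:
  assumes "0 < x"
  shows "sigma \<kappa> (osuc x) = sigma \<kappa> x + ocard {..<sigma \<kappa> x}"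
proof -
  have "osuc x \<noteq> 1"
    using assms by (simp add: one_ordinal_def ordinal_zero_less_iff)
  then show ?thesis
    by (subst sigma.simps) (simp add: is_limit_def)
qed

lemma sigma_limit:
  assumes "is_limit x"
  shows "sigma \<kappa> x = (SUP y\<in>{..<x}. sigma \<kappa> y)"
proof -
  have "x \<noteq> 0" "x \<noteq> 1"
    using assms by (auto simp: is_limit_def one_ordinal_def ordinal_zero_less_iff)
  then show ?thesis
    using assms by (subst sigma.simps) simp
qed

text \<open>\<open>sigma_normal_form \<kappa> \<delta> [\<alpha>\<^sub>0, \<dots>, \<alpha>\<^sub>n\<^sub>-\<^sub>1] \<Delta>\<close>:
  \<open>\<delta> = \<sigma>(\<alpha>\<^sub>0) + \<dots> + \<sigma>(\<alpha>\<^sub>n\<^sub>-\<^sub>1) + \<Delta>\<close> is the canonical representation of \<open>\<delta>\<close>.\<close>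

definition sigma_normal_form ::
    "'a ordinal \<Rightarrow> 'a ordinal \<Rightarrow> 'a ordinal list \<Rightarrow> 'a ordinal \<Rightarrow> bool" where
  "sigma_normal_form \<kappa> \<delta> as \<Delta> \<longleftrightarrow>
     \<delta> = sum_list (map (sigma \<kappa>) as) + \<Delta> \<and>
     sorted_wrt (>) (map (\<lambda>\<alpha>. ocard {..<sigma \<kappa> \<alpha>} :: 'a ordinal) as) \<and>
     (as \<noteq> [] \<longrightarrow> 0 < last as) \<and>
     \<Delta> < \<kappa>"

definition gamma :: "'a ordinal \<Rightarrow> 'a ordinal \<Rightarrow> 'a ordinal" where
  "gamma \<kappa> \<delta> =
    (THE g. \<exists>as \<Delta>. sigma_normal_form \<kappa> \<delta> as \<Delta> \<and>
       g = (if as = [] then 0 else sum_list (map (sigma \<kappa>) (butlast as))))"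


section \<open>Topological notions\<close>

text \<open>
  For a space on a subset of \<open>'a\<close>, all cardinal invariants below are at most \<open>2^|'a|\<close>, so these
  cardinals and their successors are represented in \<open>'a set set ordinal\<close> whenever \<open>'a\<close> is infinite.
\<close>

definition initially_compact :: "'b ordinal \<Rightarrow> 'a topology \<Rightarrow> bool" where
  "initially_compact \<kappa> X \<longleftrightarrow>
     (\<forall>\<U>. (\<forall>U\<in>\<U>. openin X U) \<and> \<Union>\<U> = topspace X \<and> \<U> \<lesssim> {..<\<kappa>} \<longrightarrow>
        (\<exists>\<V>\<subseteq>\<U>. finite \<V> \<and> \<Union>\<V> = topspace X))"

text \<open>Sequences of length \<open>\<mu>\<close> are functions on the ordinals, restricted to \<open>{..<\<mu>}\<close>.\<close>

definition free_sequence :: "'a topology \<Rightarrow> 'b ordinal \<Rightarrow> ('b ordinal \<Rightarrow> 'a) \<Rightarrow> bool" where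
  "free_sequence X \<mu> p \<longleftrightarrow>
     p ` {..<\<mu>} \<subseteq> topspace X \<and>
     (\<forall>\<delta><\<mu>. X closure_of (p ` {..<\<delta>}) \<inter> X closure_of (p ` {\<delta>..<\<mu>}) = {})"

definition left_separated :: "'a topology \<Rightarrow> 'b ordinal \<Rightarrow> ('b ordinal \<Rightarrow> 'a) \<Rightarrow> bool" where
  "left_separated X \<mu> p \<longleftrightarrow>
     p ` {..<\<mu>} \<subseteq> topspace X \<and>
     (\<forall>\<delta><\<mu>. X closure_of (p ` {..<\<delta>}) \<inter> p ` {\<delta>..<\<mu>} = {})"

text \<open>
  Members of an indexed family are counted with multiplicity; for the set of its members this
  gives the usual notion, see the lemma below.
\<close>

definition point_at_most :: "'b ordinal \<Rightarrow> 'a topology \<Rightarrow> ('i \<Rightarrow> 'a set) \<Rightarrow> 'i set \<Rightarrow> bool" where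
  "point_at_most \<kappa> X R I \<longleftrightarrow> (\<forall>x\<in>topspace X. {i \<in> I. x \<in> R i} \<lesssim> {..<\<kappa>})"

lemma point_at_most_imp_members:
  assumes "point_at_most \<kappa> X R I" "x \<in> topspace X"
  shows "{A \<in> R ` I. x \<in> A} \<lesssim> {..<\<kappa>}"
proof -
  have "{A \<in> R ` I. x \<in> A} = R ` {i \<in> I. x \<in> R i}"
    by blast
  moreover have "{i \<in> I. x \<in> R i} \<lesssim> {..<\<kappa>}"
    using assms by (simp add: point_at_most_def)
  ultimately show ?thesis
    by (simp add: lepoll_trans[OF image_lepoll])
qed

definition nonempty_opens :: "'a topology \<Rightarrow> 'a set set" where
  "nonempty_opens X = {U. openin X U \<and> U \<noteq> {}}"

definition local_pi_base :: "'a topology \<Rightarrow> 'a \<Rightarrow> 'a set set \<Rightarrow> bool" where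
  "local_pi_base X p \<R> \<longleftrightarrow>
     \<R> \<subseteq> nonempty_opens X \<and> (\<forall>U. openin X U \<and> p \<in> U \<longrightarrow> (\<exists>R\<in>\<R>. R \<subseteq> U))"

definition point_pi_character :: "'a \<Rightarrow> 'a topology \<Rightarrow> 'a set set ordinal" where
  "point_pi_character p X = (LEAST x. \<exists>\<R>. local_pi_base X p \<R> \<and> x = ocard \<R>)"

definition pi_character :: "'a topology \<Rightarrow> 'a set set ordinal" where
  "pi_character X = (SUP p\<in>topspace X. point_pi_character p X)"

definition top_density :: "'a topology \<Rightarrow> 'a set set ordinal" where
  "top_density X =
     (LEAST x. \<exists>D. D \<subseteq> topspace X \<and> X closure_of D = topspace X \<and> x = ocard D)"

text \<open>The factor \<open>topspace X\<close> makes the intersection of the empty family equal to the space.\<close>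

definition shapirovskii_pi_base ::
    "'a topology \<Rightarrow> ('a set set ordinal \<Rightarrow> 'a) \<Rightarrow>
     ('a set set ordinal \<times> 'a set set ordinal \<Rightarrow> 'a set) \<Rightarrow> bool" where
  "shapirovskii_pi_base X p S \<longleftrightarrow>
    (let \<kappa> = pi_character X; \<mu> = top_density X in
      regular_space X \<and> t1_space X \<and> infinite_cardinal \<kappa> \<and> infinite_cardinal \<mu> \<and>
      S ` ({..<\<mu>} \<times> {..<\<kappa>}) \<subseteq> nonempty_opens X \<and>
      X closure_of (p ` {..<\<mu>}) = topspace X \<and> left_separated X \<mu> p \<and>
      (\<forall>\<alpha><\<mu>. local_pi_base X (p \<alpha>) ((\<lambda>i. S (\<alpha>, i)) ` {..<\<kappa>})) \<and>
      (\<forall>\<alpha><\<mu>. X closure_of (p ` {..<\<alpha>}) \<inter>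
         (\<Union>a \<in> {\<alpha>..<\<mu>} \<times> {..<\<kappa>}. X closure_of S a) = {}) \<and>
      (\<forall>\<delta> A. 0 < \<delta> \<and> \<delta> \<le> \<mu> \<and> (\<exists>\<epsilon>. \<delta> = \<kappa> * \<epsilon>) \<and>
         finite A \<and> A \<subseteq> {gamma \<kappa> \<delta>..<\<delta>} \<times> {..<\<kappa>} \<and>
         topspace X \<inter> (\<Inter>a\<in>A. X closure_of S a) \<noteq> {} \<longrightarrow>
         topspace X \<inter> (\<Inter>a\<in>A. X closure_of S a) \<inter>
           (\<Union>\<alpha>\<in>{..<\<delta>}. X closure_of (p ` {..<\<alpha>})) \<noteq> {}))"

end

theory Submission
  imports Defs
begin

text \<open>
  Suppose that \<open>x\<close> lies in more than \<open>\<kappa>\<close> members of the \<open>\<pi>\<close>-base. Then more than \<open>\<kappa>\<close> ordinals \<open>\<alpha>\<close>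
  satisfy \<open>x \<in> S(\<alpha>, i)\<close> for some \<open>i = i(\<alpha>)\<close>; let \<open>H\<close> be the set of these and \<open>\<eta>\<close> the least ordinal
  with \<open>|H \<inter> \<eta>| > \<kappa>\<close>. No subset of \<open>\<eta>\<close> of size at most \<open>\<kappa>\<close> is cofinal in \<open>\<eta>\<close>, and from the normal
  form of \<open>\<eta>\<close> one reads off a single \<open>g < \<eta>\<close> which is the value of \<open>\<gamma>\<close> at cofinally many multiples
  \<open>\<delta> < \<eta>\<close> of \<open>\<kappa>\<close>. Choose \<open>t(\<xi>) \<in> H \<inter> [g, \<eta>)\<close> for \<open>\<xi> < \<kappa>\<^sup>+\<close> and such multiples \<open>\<delta>(\<xi>)\<close> with
  \<open>t(\<xi>) < \<delta>(\<xi>) < t(\<xi>')\<close> whenever \<open>\<xi> < \<xi>'\<close>. By (c) and initial \<open>\<kappa>\<close>-compactness there is a point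
  \<open>q(\<xi>)\<close> in the closure of \<open>P\<^bsub>\<delta>(\<xi>)\<^esub>\<close> and in the closures of all \<open>S(t(\<zeta>), i(t(\<zeta>)))\<close> with \<open>\<zeta> \<le> \<xi>\<close>, and
  (b) shows that these points form a free sequence of length \<open>\<kappa>\<^sup>+\<close>.
\<close>

section \<open>Ordinal arithmetic\<close>

lemma ordinal_eqI:
  fixes x y :: "'a ordinal"
  assumes "\<And>z. z < x \<longleftrightarrow> z < y"
  shows "x = y"
  using assms[of x] assms[of y] by (cases x y rule: linorder_cases) auto

lemma ordinal_cases_osuc_limit:
  fixes x :: "'a ordinal"
  obtains (zero) "x = 0" | (osuc) y where "x = osuc y" | (limit) "is_limit x"
  using ordinal_zero_less_iff is_limit_def by blast

lemma osuc_le_iff: "osuc x \<le> y \<longleftrightarrow> x < y"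
  by (metis less_osuc_iff not_le)

lemma is_limit_osuc_less: "is_limit x \<Longrightarrow> y < x \<Longrightarrow> osuc y < x"
  by (metis is_limit_def order_le_less osuc_le_iff)

lemma plus_le_cancel_left: "(x :: 'a ordinal) + y \<le> x + z \<longleftrightarrow> y \<le> z"
  by (meson not_le plus_less_cancel_left)

lemma plus_eq_cancel_left: "(x :: 'a ordinal) + y = x + z \<longleftrightarrow> y = z"
  by (metis order.antisym order.refl plus_le_cancel_left)

lemma le_plus_right: "(x :: 'a ordinal) \<le> x + y"
  by (metis add_0_right ordinal_zero_le plus_le_cancel_left)

lemma less_plus_right: "0 < y \<Longrightarrow> (x :: 'a ordinal) < x + y"
  by (metis add_0_right plus_less_cancel_left)

lemma plus_mono_left:
  fixes a b c :: "'a ordinal"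
  assumes "a \<le> b"
  shows "a + c \<le> b + c"
proof (induction c rule: less_induct)
  case (less c)
  have "z < b + c" if "z < a + c" for z
    using that less assms unfolding less_plus_iff[of z] by (meson order_trans order_less_le_trans)
  then show ?case
    by (meson not_le less_irrefl)
qed

lemma le_plus_left: "(y :: 'a ordinal) \<le> x + y"
  using plus_mono_left[of 0 x y] by simp

text \<open>Left subtraction: the least \<open>c\<close> with \<open>b \<le> a + c\<close> cannot
  overshoot, since \<open>b < a + c\<close> together with \<open>a \<le> b\<close> would give
  \<open>b \<le> a + w\<close> for some \<open>w < c\<close>.\<close>

lemma ordinal_difference:
  fixes a b :: "'a ordinal"
  assumes "a \<le> b"
  obtains c where "b = a + c"
proof -
  define c where "c = (LEAST c. b \<le> a + c)"
  have "b \<le> a + c"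
    unfolding c_def by (rule LeastI) (rule le_plus_left)
  moreover have "\<not> b < a + c"
    using assms not_less_Least[of _ "\<lambda>c. b \<le> a + c"] unfolding less_plus_iff c_def by fastforce
  ultimately show thesis
    using that by fastforce
qed

lemma lessThan_plus: "{..<(x :: 'a ordinal) + y} = {..<x} \<union> (+) x ` {..<y}"
proof safe
  fix z assume "z < x + y" and *: "z \<notin> (+) x ` {..<y}"
  show "z < x"
  proof (rule ccontr)
    assume "\<not> z < x"
    then obtain c where "z = x + c"
      using ordinal_difference[of x z] by fastforce
    then show False
      using \<open>z < x + y\<close> * by (auto simp: plus_less_cancel_left)
  qed
qed (auto simp: plus_less_cancel_left intro: order_less_le_trans le_plus_right)

lemma strict_mono_ordinal_le:
  fixes f :: "'a ordinal \<Rightarrow> 'a ordinal"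
  assumes "strict_mono f"
  shows "x \<le> f x"
proof (induction x rule: less_induct)
  case (less x)
  then show ?case
    using assms by (meson not_le strict_monoD)
qed

text \<open>The least \<open>z\<close> with \<open>y < f z\<close> is not 0 and, by continuity, not
  a limit, so it is some \<open>osuc x\<close>. Applied below to multiples of a fixed ordinal and to
  \<open>sigma\<close>.\<close>

lemma normal_function_bracket:
  fixes f :: "'a ordinal \<Rightarrow> 'a ordinal"
  assumes mono: "strict_mono f" and "f 0 \<le> y"
    and continuous: "\<And>x. is_limit x \<Longrightarrow> y < f x \<Longrightarrow> \<exists>w<x. y < f w"
  obtains x where "f x \<le> y" "y < f (osuc x)"
proof -
  define z where "z = (LEAST z. y < f z)"
  have "y < f (osuc y)"
    by (meson less_osuc_iff mono order_le_less_trans order.refl strict_monoD strict_mono_ordinal_le)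
  then have z: "y < f z"
    unfolding z_def by (rule LeastI)
  have less: "f w \<le> y" if "w < z" for w
    using that not_less_Least unfolding z_def by (meson not_le)
  show thesis
  proof (cases z rule: ordinal_cases_osuc_limit)
    case (osuc x)
    then show ?thesis
      using that[of x] z less[of x] by simp
  next
    case zero
    then show ?thesis
      using z assms(2) by simp
  next
    case limit
    then show ?thesis
      using continuous[OF limit z] less by (meson not_le)
  qed
qed

lemma less_times_iff: "z < (x :: 'a ordinal) * y \<longleftrightarrow> (\<exists>w<y. z < x * w + x)"
proof (cases "y = 0")
  case False
  then have "{..<y} \<noteq> {}"
    by (metis ordinal_zero_less_iff empty_iff lessThan_iff)
  then show ?thesis
    using False by (subst times_ordinal.simps) (simp add: less_cSup_iff, blast)
qed (simp add: times_ordinal.simps)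

lemma times_zero: "(x :: 'a ordinal) * 0 = 0"
  by (simp add: times_ordinal.simps)

lemma strict_mono_times:
  assumes "0 < (x :: 'a ordinal)"
  shows "strict_mono ((*) x)"
  using assms less_times_iff less_plus_right by (intro strict_monoI) blast

lemma times_osuc: "(x :: 'a ordinal) * osuc y = x * y + x"
proof (rule ordinal_eqI)
  fix z
  have "x * w \<le> x * y" if "w \<le> y" for w
    using that less_times_iff by (metis (no_types) leI order.asym order_less_le_trans)
  then show "z < x * osuc y \<longleftrightarrow> z < x * y + x"
    unfolding less_times_iff by (metis less_osuc_iff order.refl order_less_le_trans plus_mono_left)
qed

text \<open>Bracket \<open>x\<close> between \<open>k * e\<close> and \<open>k * e + k\<close>; if
  \<open>k * e < x\<close>, the closure property gives \<open>k * e + k \<le> x\<close>, a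
  contradiction.\<close>

lemma multiple_if_plus_le:
  fixes k x :: "'a ordinal"
  assumes "0 < k" and closed: "\<And>z. z < x \<Longrightarrow> z + k \<le> x"
  obtains e where "x = k * e"
proof -
  have "\<exists>w<y. x < k * w" if "is_limit y" "x < k * y" for y
    using that is_limit_osuc_less unfolding less_times_iff[of _ _ y] times_osuc[symmetric] by blast
  then obtain e where e: "k * e \<le> x" "x < k * osuc e"
    using normal_function_bracket[OF strict_mono_times[OF assms(1)], of x]
    by (metis ordinal_zero_le times_zero)
  then have "x = k * e"
    using closed[of "k * e"] by (metis not_le order_le_less times_osuc)
  then show thesis ..
qed


section \<open>Cardinals\<close>

lemma lepoll_lessThan: "(x :: 'a ordinal) \<le> y \<Longrightarrow> {..<x} \<lesssim> {..<y}"
  by (simp add: subset_imp_lepoll)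

lemma eqpoll_ocard: "{..<(x :: 'a ordinal)} \<approx> {..<ocard {..<x} :: 'a ordinal}"
  unfolding ocard_def by (rule LeastI[of _ x]) simp

lemma ocard_le_iff:
  "ocard {..<(x :: 'a ordinal)} \<le> (ocard {..<(y :: 'a ordinal)} :: 'a ordinal) \<longleftrightarrow> {..<x} \<lesssim> {..<y}"
proof
  assume "ocard {..<x} \<le> (ocard {..<y} :: 'a ordinal)"
  then have "{..<ocard {..<x} :: 'a ordinal} \<lesssim> {..<ocard {..<y} :: 'a ordinal}"
    by (rule lepoll_lessThan)
  then show "{..<x} \<lesssim> {..<y}"
    using eqpoll_ocard[of x] eqpoll_ocard[of y] eqpoll_sym lepoll_trans1 lepoll_trans2 by metis
next
  assume le: "{..<x} \<lesssim> {..<y}"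
  show "ocard {..<x} \<le> (ocard {..<y} :: 'a ordinal)"
  proof (rule ccontr)
    assume not_le: "\<not> ?thesis"
    then have "{..<ocard {..<y} :: 'a ordinal} \<lesssim> {..<ocard {..<x} :: 'a ordinal}"
      by (simp add: lepoll_lessThan)
    then have "{..<y} \<lesssim> {..<x}"
      using eqpoll_ocard[of x] eqpoll_ocard[of y] eqpoll_sym lepoll_trans1 lepoll_trans2 by metis
    then have "{..<x} \<approx> {..<ocard {..<y} :: 'a ordinal}"
      using le eqpoll_ocard lepoll_antisym eqpoll_trans by metis
    then have "ocard {..<x} \<le> (ocard {..<y} :: 'a ordinal)"
      unfolding ocard_def[of "{..<x}"] by (rule Least_le)
    with not_le show False ..
  qed
qed

lemma ocard_mono: "(x :: 'a ordinal) \<le> y \<Longrightarrow> ocard {..<x} \<le> (ocard {..<y} :: 'a ordinal)"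
  by (simp add: ocard_le_iff lepoll_lessThan)

lemma ocard_le: "ocard {..<(x :: 'a ordinal)} \<le> x"
  unfolding ocard_def by (rule Least_le) simp

lemma is_cardinal_ocard: "is_cardinal (ocard {..<(x :: 'a ordinal)} :: 'a ordinal)"
proof -
  have "{..<ocard {..<x} :: 'a ordinal} \<approx> {..<x}"
    by (rule eqpoll_sym[OF eqpoll_ocard])
  then show ?thesis
    unfolding is_cardinal_def by (intro order.antisym; simp add: ocard_le_iff eqpoll_imp_lepoll eqpoll_sym)
qed

lemma ocard_less_cardinal_iff:
  assumes "is_cardinal (c :: 'a ordinal)"
  shows "ocard {..<x} < c \<longleftrightarrow> x < c"
  using assms ocard_mono[of c x] ocard_le[of x] unfolding is_cardinal_def
  by (metis not_le order_le_less_trans)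

lemma less_cardinal_iff:
  assumes "is_cardinal (c :: 'a ordinal)"
  shows "x < c \<longleftrightarrow> \<not> {..<c} \<lesssim> {..<x}"
  using assms ocard_less_cardinal_iff[OF assms, of x] ocard_le_iff[of c x] unfolding is_cardinal_def
  by (simp add: not_le[symmetric])

lemma infinite_cardinal_pos: "infinite_cardinal \<kappa> \<Longrightarrow> 0 < \<kappa>"
  unfolding infinite_cardinal_def by (metis empty_iff finite.emptyI lessThan_iff ordinal_not_less_zero
      ordinal_zero_less_iff subsetI subset_empty)

lemma infinite_cardinal_ocard:
  fixes \<kappa> x :: "'a ordinal"
  assumes "infinite_cardinal \<kappa>" "\<kappa> \<le> x"
  shows "infinite_cardinal (ocard {..<x} :: 'a ordinal)" "\<kappa> \<le> ocard {..<x}"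
proof -
  show le: "\<kappa> \<le> ocard {..<x}"
    using assms by (metis infinite_cardinal_def ocard_less_cardinal_iff not_le)
  then have "{..<\<kappa>} \<subseteq> {..<ocard {..<x}}"
    by auto
  then show "infinite_cardinal (ocard {..<x} :: 'a ordinal)"
    using assms(1) infinite_super[of "{..<\<kappa>}"] by (simp add: infinite_cardinal_def is_cardinal_ocard)
qed

lemma finite_lepoll: "A \<lesssim> B \<Longrightarrow> finite B \<Longrightarrow> finite A"
  by (metis finite_surj lepoll_iff)

lemma lepoll_infinite_UN:
  assumes "infinite C" "I \<lesssim> C" "\<And>i. i \<in> I \<Longrightarrow> A i \<lesssim> C"
  shows "(\<Union>i\<in>I. A i) \<lesssim> C"
  using card_of_UNION_ordLeq_infinite[of C I A] assms by (simp add: lepoll_iff_ordLeq)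

lemma lepoll_infinite_insert:
  assumes "infinite C" "A \<lesssim> C"
  shows "insert a A \<lesssim> C"
  by (metis assms finite.insertI finite_lepoll_infinite infinite_insert_lepoll lepoll_trans)

text \<open>The segment below \<open>x + y\<close> is the segment below \<open>x\<close> and a
  translate of the one below \<open>y\<close>, both no larger than \<open>m = max x y < c\<close>.
  So it is finite or injects into \<open>{..<m}\<close>, and \<open>{..<c}\<close> cannot inject
  into it.\<close>

lemma infinite_cardinal_plus_less:
  fixes c :: "'a ordinal"
  assumes "infinite_cardinal c" "x < c" "y < c"
  shows "x + y < c"
proof (rule ccontr)
  assume "\<not> x + y < c"
  then have le: "{..<c} \<lesssim> {..<x + y}"
    by (simp add: lepoll_lessThan)
  define m where "m = max x y"
  have m: "{..<x} \<lesssim> {..<m}" "(+) x ` {..<y} \<lesssim> {..<m}" "m < c"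
    using assms unfolding m_def
    by (auto intro!: lepoll_lessThan lepoll_trans[OF image_lepoll])
  show False
  proof (cases "finite {..<m}")
    case True
    then have "finite {..<x + y}"
      unfolding lessThan_plus using m by (meson finite_Un finite_lepoll)
    then show False
      using le assms(1) finite_lepoll unfolding infinite_cardinal_def by blast
  next
    case False
    then have "{..<x + y} \<lesssim> {..<m}"
      unfolding lessThan_plus
      using lepoll_infinite_UN[of "{..<m}" "{{..<x}, (+) x ` {..<y}}" "\<lambda>A. A"] m
      by (auto simp: finite_lepoll_infinite)
    then show False
      using le m(3) assms(1) less_cardinal_iff lepoll_trans unfolding infinite_cardinal_def by blast
  qed
qed

text \<open>Otherwise \<open>ocard {..<x}\<close> would be a cardinal above \<kappa> and below
  \<open>cardinal_succ \<kappa>\<close>, against leastness.\<close>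

lemma lessThan_cardinal_succ_lepoll:
  assumes "infinite_cardinal (\<kappa> :: 'a ordinal)" "x < cardinal_succ \<kappa>"
  shows "{..<x} \<lesssim> {..<\<kappa>}"
proof -
  have "\<not> \<kappa> < ocard {..<x}"
    using assms(2) not_less_Least[of "ocard {..<x}" "\<lambda>y. is_cardinal y \<and> \<kappa> < y"]
      is_cardinal_ocard[of x] ocard_le[of x]
    unfolding cardinal_succ_def by (meson order_le_less_trans)
  then show ?thesis
    using assms(1) ocard_le_iff[of x \<kappa>] by (simp add: infinite_cardinal_def is_cardinal_def not_less)
qed


section \<open>The functions \<open>\<sigma>\<close> and \<open>\<gamma>\<close>\<close>

context
  fixes \<kappa> :: "'a ordinal"
  assumes \<kappa>: "infinite_cardinal \<kappa>"
begin

section \<open>Growth and closure properties of \<open>sigma\<close>\<close>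

lemma less_sigma_limit: "is_limit x \<Longrightarrow> y < sigma \<kappa> x \<Longrightarrow> \<exists>w<x. y < sigma \<kappa> w"
  using less_cSup_iff[of "sigma \<kappa> ` {..<x}" y] by (auto simp: sigma_limit[of x] is_limit_def)

lemma sigma_le_limit: "is_limit x \<Longrightarrow> y < x \<Longrightarrow> sigma \<kappa> y \<le> sigma \<kappa> x"
  by (simp add: sigma_limit[of x] cSUP_upper)

lemma strict_mono_sigma: "strict_mono (sigma \<kappa>)"
proof (rule strict_monoI)
  fix y x :: "'a ordinal"
  show "y < x \<Longrightarrow> sigma \<kappa> y < sigma \<kappa> x"
  proof (induction x arbitrary: y rule: less_induct)
    case (less x)
    show ?case
    proof (cases x rule: ordinal_cases_osuc_limit)
      case zero
      then show ?thesis
        using less.prems by simp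
    next
      case (osuc z)
      have "sigma \<kappa> z < sigma \<kappa> x"
      \<comment> \<open>The rule \<open>sigma_osuc\<close> starts only above 0; the first step jumps
        from 0 to \<kappa>.\<close>
      proof (cases "z = 0")
        case True
        then show ?thesis
          using osuc infinite_cardinal_pos[OF \<kappa>] sigma_1[of \<kappa>] by (simp add: sigma_0 one_ordinal_def)
      next
        case False
        then have "0 < z"
          by (simp add: ordinal_zero_less_iff)
        then have "0 < sigma \<kappa> z"
          using less.IH[of z 0] osuc by (simp add: sigma_0)
        then have "\<not> {..<sigma \<kappa> z} \<lesssim> {..<0 :: 'a ordinal}"
          by (metis ordinal_not_less_zero lepoll_empty_iff_empty empty_iff lessThan_iff subsetI subset_empty)
        then have "0 < (ocard {..<sigma \<kappa> z} :: 'a ordinal)"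
          using eqpoll_ocard[of "sigma \<kappa> z"] ordinal_zero_less_iff by (metis eqpoll_imp_lepoll)
        then show ?thesis
          using \<open>0 < z\<close> by (simp add: osuc sigma_osuc less_plus_right)
      qed
      moreover have "y = z \<or> y < z"
        using less.prems osuc by auto
      ultimately show ?thesis
        using less.IH[of z y] osuc by fastforce
    next
      case limit
      then have "osuc y < x"
        using less.prems by (rule is_limit_osuc_less)
      then show ?thesis
        using less.IH[of "osuc y" y] sigma_le_limit[OF limit] by fastforce
    qed
  qed
qed

lemma le_sigma: "0 < x \<Longrightarrow> \<kappa> \<le> sigma \<kappa> x"
  by (metis sigma_1 strict_mono_sigma strict_mono_less_eq one_ordinal_def osuc_le_iff)

lemmas infinite_cardinal_ocard_sigma = infinite_cardinal_ocard[OF \<kappa> le_sigma]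

text \<open>The bracket between consecutive values of \<open>sigma\<close>, where
  \<open>\<kappa> \<le> y\<close> excludes \<open>x = 0\<close>. It finds the leading term of a
  normal form.\<close>

lemma sigma_bracket:
  assumes "\<kappa> \<le> y"
  obtains x where "0 < x" "sigma \<kappa> x \<le> y" "y < sigma \<kappa> x + ocard {..<sigma \<kappa> x}"
proof -
  obtain x where x: "sigma \<kappa> x \<le> y" "y < sigma \<kappa> (osuc x)"
    using normal_function_bracket[OF strict_mono_sigma] less_sigma_limit
    by (metis sigma_0 ordinal_zero_le)
  then have "0 < x"
    using assms sigma_1[of \<kappa>] unfolding ordinal_zero_less_iff one_ordinal_def by fastforce
  then show thesis
    using that x by (simp add: sigma_osuc)
qed

text \<open>The closure property that makes values of \<open>sigma\<close> multiples of \<kappa>. At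
  a successor the added summand is an infinite cardinal \<open>c\<close> with
  \<open>\<kappa> \<le> c\<close>, and \<open>u + \<kappa> \<le> c\<close> for \<open>u < c\<close>
  because \<open>c\<close> is closed under sums.\<close>

lemma sigma_plus_le: "z < sigma \<kappa> x \<Longrightarrow> z + \<kappa> \<le> sigma \<kappa> x"
proof (induction x arbitrary: z rule: less_induct)
  case (less x)
  show ?case
  proof (cases x rule: ordinal_cases_osuc_limit)
    case zero
    then show ?thesis
      using less.prems by (simp add: sigma_0)
  next
    case (osuc y)
    have card: "u + \<kappa> \<le> c" if "infinite_cardinal c" and "\<kappa> \<le> c" and "u < c" for u c :: "'a ordinal"
    proof (rule leI, rule notI)
      assume "c < u + \<kappa>"
      then obtain w where "w < \<kappa>" "c \<le> u + w"
        using \<open>u < c\<close> unfolding less_plus_iff[of c] by auto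
      then show False
        using infinite_cardinal_plus_less[OF that(1) \<open>u < c\<close>, of w] \<open>\<kappa> \<le> c\<close>
        by (meson not_le order_less_le_trans)
    qed
    show ?thesis
    proof (cases "y = 0")
      case True
      then have "sigma \<kappa> x = \<kappa>"
        using osuc sigma_1 by (simp add: one_ordinal_def)
      then show ?thesis
        using less.prems card[OF \<kappa>] by simp
    next
      case False
      then have y: "0 < y"
        by (simp add: ordinal_zero_less_iff)
      let ?c = "ocard {..<sigma \<kappa> y} :: 'a ordinal"
      have x: "sigma \<kappa> x = sigma \<kappa> y + ?c"
        using y osuc by (simp add: sigma_osuc)
      from less.prems consider "z < sigma \<kappa> y" | w where "w < ?c" "z \<le> sigma \<kappa> y + w"
        unfolding x less_plus_iff[of z] by blast
      then show ?thesis
      proof cases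
        case 1
        then show ?thesis
          using less.IH[of y z] osuc x le_plus_right order_trans by (metis less_osuc_iff order.refl)
      next
        case 2
        then have "z + \<kappa> \<le> sigma \<kappa> y + (w + \<kappa>)"
          by (simp add: plus_mono_left flip: add.assoc)
        also have "\<dots> \<le> sigma \<kappa> x"
          using 2 card infinite_cardinal_ocard_sigma[OF y] by (simp add: x plus_le_cancel_left)
        finally show ?thesis .
      qed
    qed
  next
    case limit
    then obtain y where "y < x" "z < sigma \<kappa> y"
      using less_sigma_limit less.prems by blast
    then show ?thesis
      using less.IH sigma_le_limit[OF limit] order_trans by blast
  qed
qed

lemma sigma_sum_plus_le:
  "z < sum_list (map (sigma \<kappa>) as) \<Longrightarrow> z + \<kappa> \<le> sum_list (map (sigma \<kappa>) as)"
proof (induction as arbitrary: z)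
  case (Cons a as)
  let ?s = "sum_list (map (sigma \<kappa>) as)"
  from Cons.prems consider "z < sigma \<kappa> a" | w where "w < ?s" "z \<le> sigma \<kappa> a + w"
    using less_plus_iff[of z "sigma \<kappa> a" ?s] by auto
  then show ?case
  proof cases
    case 1
    then have "z + \<kappa> \<le> sigma \<kappa> a"
      by (rule sigma_plus_le)
    also have "\<dots> \<le> sigma \<kappa> a + ?s"
      by (rule le_plus_right)
    finally show ?thesis
      by simp
  next
    case 2
    then have "z + \<kappa> \<le> sigma \<kappa> a + (w + \<kappa>)"
      by (simp add: plus_mono_left flip: add.assoc)
    also have "\<dots> \<le> sigma \<kappa> a + ?s"
      using 2 Cons.IH by (simp add: plus_le_cancel_left)
    finally show ?thesis
      by simp
  qed
qed simp

text \<open>Condition (c) of a Shapirovskii \<pi>-base is available only at multiples of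
  \<kappa>.\<close>

lemma sigma_sum_multiple: "\<exists>e. sum_list (map (sigma \<kappa>) as) = \<kappa> * e"
  using multiple_if_plus_le[OF infinite_cardinal_pos[OF \<kappa>]] sigma_sum_plus_le by metis

section \<open>Normal forms and the values of \<open>gamma\<close>\<close>

lemma sigma_sum_less_cardinal:
  assumes "infinite_cardinal c" "\<And>a. a \<in> set as \<Longrightarrow> sigma \<kappa> a < c" "d < c"
  shows "sum_list (map (sigma \<kappa>) as) + d < c"
  using assms(2) by (induction as) (auto simp: assms(1,3) add.assoc intro!: infinite_cardinal_plus_less)

text \<open>All later summands have smaller cardinality than \<open>sigma \<kappa> a\<close>, and
  infinite cardinals are closed under finite sums, so the tail stays below
  \<open>ocard {..<sigma \<kappa> a}\<close>.\<close>

lemma sigma_normal_form_ConsD: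
  assumes "sigma_normal_form \<kappa> \<delta> (a # as) \<Delta>"
  obtains \<rho> where "0 < a" "\<delta> = sigma \<kappa> a + \<rho>" "\<rho> < ocard {..<sigma \<kappa> a}"
    "sigma_normal_form \<kappa> \<rho> as \<Delta>"
proof -
  let ?c = "ocard {..<sigma \<kappa> a} :: 'a ordinal"
  have less: "ocard {..<sigma \<kappa> b} < ?c" if "b \<in> set as" for b
    using assms that by (simp add: sigma_normal_form_def)
  have "0 < a"
  proof (cases "as = []")
    case True
    then show ?thesis
      using assms by (simp add: sigma_normal_form_def)
  next
    case False
    \<comment> \<open>If further summands follow, \<open>a = 0\<close> is excluded because
      \<open>sigma \<kappa> 0 = 0\<close> leaves no room for a strictly smaller cardinality.\<close>
    then have "ocard {..<sigma \<kappa> (hd as)} < ?c"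
      using less by simp
    then have "a \<noteq> 0"
      using ocard_le[of "sigma \<kappa> a"] by (metis ordinal_not_less_zero order_less_le_trans sigma_0)
    then show ?thesis
      by (simp add: ordinal_zero_less_iff)
  qed
  note c = infinite_cardinal_ocard_sigma[OF \<open>0 < a\<close>]
  have "sigma \<kappa> b < ?c" if "b \<in> set as" for b
    using less[OF that] ocard_less_cardinal_iff is_cardinal_ocard by blast
  moreover have "\<Delta> < ?c"
    using assms c(2) by (auto simp: sigma_normal_form_def)
  ultimately have "sum_list (map (sigma \<kappa>) as) + \<Delta> < ?c"
    using sigma_sum_less_cardinal[OF c(1)] by blast
  then show thesis
    using \<open>0 < a\<close> assms by (intro that) (auto simp: sigma_normal_form_def add.assoc)
qed

text \<open>The leading index is the only \<open>a\<close> with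
  \<open>sigma \<kappa> a \<le> \<delta> < sigma \<kappa> (osuc a)\<close>; cancelling its summand
  leaves equal remainders. A nonempty form is at least \<kappa>, the empty one below
  \<kappa>.\<close>

lemma sigma_normal_form_unique:
  "sigma_normal_form \<kappa> \<delta> as \<Delta> \<Longrightarrow> sigma_normal_form \<kappa> \<delta> bs \<Delta>' \<Longrightarrow> as = bs"
proof (induction as arbitrary: \<delta> bs)
  case Nil
  show ?case
  proof (cases bs)
    case (Cons b bs')
    then obtain \<rho> where "0 < b" "\<delta> = sigma \<kappa> b + \<rho>"
      using Nil sigma_normal_form_ConsD by metis
    then have "\<kappa> \<le> \<delta>"
      using le_sigma le_plus_right order_trans by blast
    then show ?thesis
      using Nil(1) by (simp add: sigma_normal_form_def not_le[symmetric])
  qed simp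
next
  case (Cons a as)
  obtain \<rho> where a: "0 < a" "\<delta> = sigma \<kappa> a + \<rho>" "\<rho> < ocard {..<sigma \<kappa> a}"
    "sigma_normal_form \<kappa> \<rho> as \<Delta>"
    using Cons.prems(1) by (rule sigma_normal_form_ConsD)
  show ?case
  proof (cases bs)
    case Nil
    have "\<kappa> \<le> \<delta>"
      unfolding a(2) by (rule order_trans[OF le_sigma[OF a(1)] le_plus_right])
    then show ?thesis
      using Cons.prems(2) Nil by (simp add: sigma_normal_form_def not_le[symmetric])
  next
    case (Cons b bs')
    then obtain \<rho>' where b: "0 < b" "\<delta> = sigma \<kappa> b + \<rho>'" "\<rho>' < ocard {..<sigma \<kappa> b}"
      "sigma_normal_form \<kappa> \<rho>' bs' \<Delta>'"
      using Cons.prems(2) sigma_normal_form_ConsD by metis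
    have "\<delta> < sigma \<kappa> (osuc a)" "\<delta> < sigma \<kappa> (osuc b)" "sigma \<kappa> a \<le> \<delta>" "sigma \<kappa> b \<le> \<delta>"
      using a b by (metis sigma_osuc plus_less_cancel_left le_plus_right)+
    then have "a < osuc b" "b < osuc a"
      using strict_mono_less[OF strict_mono_sigma] by (meson order_le_less_trans)+
    then have "a = b"
      by simp
    then have "\<rho> = \<rho>'"
      using a(2) b(2) by (simp add: plus_eq_cancel_left)
    then show ?thesis
      using Cons.IH a b \<open>a = b\<close> Cons by blast
  qed
qed

lemma gamma_eq:
  assumes "sigma_normal_form \<kappa> \<delta> (as @ [a]) \<Delta>"
  shows "gamma \<kappa> \<delta> = sum_list (map (sigma \<kappa>) as)"
  unfolding gamma_def
proof (rule the_equality)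
  show "\<exists>bs \<Delta>. sigma_normal_form \<kappa> \<delta> bs \<Delta> \<and>
      sum_list (map (sigma \<kappa>) as) = (if bs = [] then 0 else sum_list (map (sigma \<kappa>) (butlast bs)))"
    using assms by (intro exI[of _ "as @ [a]"] exI[of _ \<Delta>]) simp
next
  fix g
  assume "\<exists>bs \<Delta>. sigma_normal_form \<kappa> \<delta> bs \<Delta> \<and>
      g = (if bs = [] then 0 else sum_list (map (sigma \<kappa>) (butlast bs)))"
  then show "g = sum_list (map (sigma \<kappa>) as)"
    using sigma_normal_form_unique[OF assms] by fastforce
qed

text \<open>Greedy choice: \<open>sigma_bracket\<close> gives the leading term, and the remainder is
  smaller than \<delta>. Each summand of the remainder is at most the remainder, hence below the
  cardinal \<open>?c\<close>, so cardinalities strictly decrease.\<close>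

lemma sigma_normal_form_exists: "\<exists>as \<Delta>. sigma_normal_form \<kappa> \<delta> as \<Delta>"
proof (induction \<delta> rule: less_induct)
  case (less \<delta>)
  show ?case
  proof (cases "\<delta> < \<kappa>")
    case True
    then have "sigma_normal_form \<kappa> \<delta> [] \<delta>"
      by (simp add: sigma_normal_form_def)
    then show ?thesis
      by blast
  next
    case False
    then have "\<kappa> \<le> \<delta>"
      by simp
    then obtain a where a: "0 < a" "sigma \<kappa> a \<le> \<delta>" "\<delta> < sigma \<kappa> a + ocard {..<sigma \<kappa> a}"
      by (rule sigma_bracket)
    obtain \<rho> where \<rho>: "\<delta> = sigma \<kappa> a + \<rho>"
      using a(2) by (rule ordinal_difference)
    let ?c = "ocard {..<sigma \<kappa> a} :: 'a ordinal"
    have less_c: "\<rho> < ?c"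
      using a(3) unfolding \<rho> by (simp only: plus_less_cancel_left)
    also have "?c \<le> \<delta>"
      using ocard_le a(2) order_trans by blast
    finally obtain as \<Delta> where as: "sigma_normal_form \<kappa> \<rho> as \<Delta>"
      using less by blast
    have "\<forall>b\<in>set as. ocard {..<sigma \<kappa> b} < ?c"
    proof
      fix b assume "b \<in> set as"
      then obtain u v where uv: "as = u @ b # v"
        by (meson split_list)
      have "\<rho> = sum_list (map (sigma \<kappa>) u) + (sigma \<kappa> b + (sum_list (map (sigma \<kappa>) v) + \<Delta>))"
        using as by (simp add: sigma_normal_form_def uv add.assoc)
      then have "sigma \<kappa> b \<le> \<rho>"
        using le_plus_right le_plus_left order_trans by metis
      then have "sigma \<kappa> b < ?c"
        using less_c by (rule order_le_less_trans)
      then show "ocard {..<sigma \<kappa> b} < ?c"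
        using ocard_less_cardinal_iff[OF is_cardinal_ocard] by blast
    qed
    then have "sigma_normal_form \<kappa> \<delta> (a # as) \<Delta>"
      using as a(1) by (simp add: sigma_normal_form_def \<rho> add.assoc)
    then show ?thesis
      by blast
  qed
qed

lemma sigma_normal_form_append1:
  "sigma_normal_form \<kappa> \<delta> (as @ [a]) 0 \<longleftrightarrow>
    \<delta> = sum_list (map (sigma \<kappa>) as) + sigma \<kappa> a \<and> 0 < a \<and>
    sorted_wrt (>) (map (\<lambda>b. ocard {..<sigma \<kappa> b} :: 'a ordinal) as) \<and>
    (\<forall>b\<in>set as. ocard {..<sigma \<kappa> a} < (ocard {..<sigma \<kappa> b} :: 'a ordinal))"
  using infinite_cardinal_pos[OF \<kappa>] by (auto simp: sigma_normal_form_def sorted_wrt_append)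

text \<open>
  The value \<open>g\<close> is obtained from the normal form of \<open>\<eta>\<close>, whose last summand is \<open>\<sigma>(\<alpha>)\<close>: if \<open>\<alpha>\<close> is a
  limit, replace it by the \<open>\<sigma>(\<beta>)\<close> with \<open>\<beta> < \<alpha>\<close>; if \<open>\<alpha> = \<beta> + 1\<close>, replace it by \<open>\<sigma>(\<beta>) + \<sigma>(\<zeta>)\<close>
  with \<open>\<sigma>(\<zeta>) < |\<sigma>(\<beta>)|\<close>.
\<close>

lemma gamma_constant_cofinally:
  assumes "\<eta> \<noteq> 0"
    and bounded: "\<And>B. B \<subseteq> {..<\<eta>} \<Longrightarrow> B \<lesssim> {..<\<kappa>} \<Longrightarrow> \<exists>h<\<eta>. \<forall>b\<in>B. b < h"
  obtains g where "g < \<eta>"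
    "\<And>h. h < \<eta> \<Longrightarrow> \<exists>\<delta>. h < \<delta> \<and> \<delta> < \<eta> \<and> gamma \<kappa> \<delta> = g \<and> (\<exists>e. \<delta> = \<kappa> * e)"
proof -
  \<comment> \<open>A final piece \<open>y \<le> \<kappa>\<close> would make the translates
    \<open>x + w\<close>, \<open>w < y\<close>, a cofinal subset of \<eta> of size at most
    \<kappa>.\<close>
  have no_short_tail: "\<kappa> < y" if "\<eta> = x + y" "0 < y" for x y
  proof (rule ccontr)
    assume "\<not> \<kappa> < y"
    then have "(+) x ` {..<y} \<lesssim> {..<\<kappa>}"
      by (intro lepoll_trans[OF image_lepoll] lepoll_lessThan) simp
    then obtain h where h: "h < \<eta>" "\<forall>b\<in>(+) x ` {..<y}. b < h"
      using bounded[of "(+) x ` {..<y}"] \<open>\<eta> = x + y\<close>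
      by (metis image_subsetI lessThan_iff plus_less_cancel_left)
    moreover have "x \<le> h"
      using h(2) that(2) by (metis add_0_right imageI lessThan_iff less_imp_le)
    ultimately show False
      using \<open>\<eta> = x + y\<close> less_plus_iff[of h x y] by (metis imageI lessThan_iff not_le)
  qed
  have multiple: "\<exists>e. \<delta> = \<kappa> * e" if "sigma_normal_form \<kappa> \<delta> as 0" for \<delta> as
    using that sigma_sum_multiple by (simp add: sigma_normal_form_def)
  obtain as \<Delta> where nf: "sigma_normal_form \<kappa> \<eta> as \<Delta>"
    using sigma_normal_form_exists by blast
  \<comment> \<open>A nonzero \<Delta> below \<kappa> would be such a short tail.\<close>
  then have "\<Delta> = 0"
    using no_short_tail[of _ \<Delta>] unfolding sigma_normal_form_def ordinal_zero_less_iff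
    by (metis order.asym)
  with nf assms(1) have "as \<noteq> []"
    by (auto simp: sigma_normal_form_def)
  then obtain bs a where "as = bs @ [a]"
    by (metis append_butlast_last_id)
  then have nf: "sigma_normal_form \<kappa> \<eta> (bs @ [a]) 0"
    using nf \<open>\<Delta> = 0\<close> by simp
  define g where "g = sum_list (map (sigma \<kappa>) bs)"
  have a: "0 < a" and \<eta>: "\<eta> = g + sigma \<kappa> a"
    using nf unfolding sigma_normal_form_append1 g_def by auto
  show thesis
  proof (cases a rule: ordinal_cases_osuc_limit)
    case zero
    with a show ?thesis by simp
  next
    case limit
    show ?thesis
    proof
      show "g < \<eta>"
        using \<eta> le_sigma[OF a] infinite_cardinal_pos[OF \<kappa>] by (auto intro: less_plus_right)
    next
      fix h assume "h < \<eta>"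
      have "\<exists>w<sigma \<kappa> a. h \<le> g + w"
        using \<open>h < \<eta>\<close> a le_sigma[OF a] infinite_cardinal_pos[OF \<kappa>]
        unfolding \<eta> less_plus_iff[of h] by (metis add_0_right less_imp_le order_less_le_trans)
      then obtain w where w: "w < sigma \<kappa> a" "h \<le> g + w"
        by blast
      then obtain b where b: "b < a" "w < sigma \<kappa> b"
        using less_sigma_limit[OF limit] by blast
      then have "0 < b"
        by (metis ordinal_not_less_zero ordinal_zero_less_iff sigma_0)
      let ?d = "g + sigma \<kappa> b"
      \<comment> \<open>The new last summand is no larger in cardinality than the old one, so the
        form stays normal and \<open>gamma\<close> still returns the prefix
        \<open>g\<close>.\<close>
      have le: "ocard {..<sigma \<kappa> b} \<le> (ocard {..<sigma \<kappa> a} :: 'a ordinal)"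
        by (rule ocard_mono[OF sigma_le_limit[OF limit b(1)]])
      have d: "sigma_normal_form \<kappa> ?d (bs @ [b]) 0"
        using nf \<open>0 < b\<close> le unfolding sigma_normal_form_append1 g_def
        by (meson order_le_less_trans)
      have "h < ?d"
        using w(2) b(2) plus_less_cancel_left order_le_less_trans by metis
      moreover have "?d < \<eta>"
        using b(1) strict_monoD[OF strict_mono_sigma] by (simp add: \<eta> plus_less_cancel_left)
      ultimately show "\<exists>\<delta>. h < \<delta> \<and> \<delta> < \<eta> \<and> gamma \<kappa> \<delta> = g \<and> (\<exists>e. \<delta> = \<kappa> * e)"
        using gamma_eq[OF d] multiple[OF d] unfolding g_def by blast
    qed
  next
    case (osuc b)
    \<comment> \<open>For \<open>b = 0\<close> the last summand would be
      \<open>sigma \<kappa> 1 = \<kappa>\<close>, again a short tail.\<close>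
    have "0 < b"
    proof (rule ccontr)
      assume "\<not> 0 < b"
      then have "sigma \<kappa> a = \<kappa>"
        using osuc sigma_1 by (simp add: ordinal_zero_less_iff one_ordinal_def)
      then show False
        using no_short_tail[OF \<eta>] infinite_cardinal_pos[OF \<kappa>] by simp
    qed
    let ?c = "ocard {..<sigma \<kappa> b} :: 'a ordinal"
    note c = infinite_cardinal_ocard_sigma[OF \<open>0 < b\<close>]
    have \<eta>2: "\<eta> = (g + sigma \<kappa> b) + ?c"
      using \<open>0 < b\<close> \<eta> by (simp add: osuc sigma_osuc add.assoc)
    have "\<kappa> < ?c"
      by (rule no_short_tail[OF \<eta>2 infinite_cardinal_pos[OF c(1)]])
    have "sigma \<kappa> b < sigma \<kappa> a"
      by (rule strict_monoD[OF strict_mono_sigma]) (simp add: osuc)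
    then have "?c \<le> ocard {..<sigma \<kappa> a}"
      by (intro ocard_mono) simp
    then have nf_b: "sigma_normal_form \<kappa> (g + sigma \<kappa> b) (bs @ [b]) 0"
      using nf \<open>0 < b\<close> unfolding sigma_normal_form_append1 g_def
      by (meson order_le_less_trans)
    show ?thesis
    proof
      show "g + sigma \<kappa> b < \<eta>"
        using \<eta>2 infinite_cardinal_pos[OF c(1)] by (auto intro: less_plus_right)
    next
      fix h assume "h < \<eta>"
      have "\<exists>w<?c. h \<le> (g + sigma \<kappa> b) + w"
        using \<open>h < \<eta>\<close> infinite_cardinal_pos[OF c(1)]
        unfolding \<eta>2 less_plus_iff[of h "g + sigma \<kappa> b"]
        by (metis add_0_right less_imp_le)
      then obtain w where w: "w < ?c" "h \<le> (g + sigma \<kappa> b) + w"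
        by blast
      \<comment> \<open>Taking the maximum with \<kappa> makes \<open>sigma_bracket\<close>
        applicable; then \<open>sigma \<kappa> (osuc x)\<close> exceeds \<open>w\<close> but, as
        \<open>?c\<close> is closed under sums, remains below \<open>?c\<close>.\<close>
      obtain x where x: "0 < x" "sigma \<kappa> x \<le> max \<kappa> w" "max \<kappa> w < sigma \<kappa> x + ocard {..<sigma \<kappa> x}"
        using sigma_bracket[of "max \<kappa> w"] by auto
      have "sigma \<kappa> x < ?c"
        using x(2) w(1) \<open>\<kappa> < ?c\<close> by (meson max_less_iff_conj order_le_less_trans)
      moreover have "ocard {..<sigma \<kappa> x} < ?c"
        using calculation ocard_less_cardinal_iff is_cardinal_ocard by blast
      ultimately have less_c: "sigma \<kappa> (osuc x) < ?c"
        using x(1) infinite_cardinal_plus_less[OF c(1)] by (simp add: sigma_osuc)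
      \<comment> \<open>The appended summand has cardinality below \<open>?c\<close>, so it is a
        further term of the normal form, and it is the one that \<open>gamma\<close> drops.\<close>
      let ?d = "(g + sigma \<kappa> b) + sigma \<kappa> (osuc x)"
      have "ocard {..<sigma \<kappa> (osuc x)} < ?c"
        using less_c ocard_less_cardinal_iff is_cardinal_ocard by blast
      moreover have "?c < ocard {..<sigma \<kappa> b'}" if "b' \<in> set bs" for b'
        using nf_b that unfolding sigma_normal_form_append1 by blast
      ultimately have d: "sigma_normal_form \<kappa> ?d ((bs @ [b]) @ [osuc x]) 0"
        using nf_b unfolding sigma_normal_form_append1 g_def
        by (auto simp: sorted_wrt_append ordinal_zero_less_iff intro: less_trans)
      have "w < sigma \<kappa> (osuc x)"
        using x by (simp add: sigma_osuc)
      then have "h < ?d"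
        using w(2) plus_less_cancel_left order_le_less_trans by metis
      moreover have "?d < \<eta>"
        using less_c by (simp add: \<eta>2 plus_less_cancel_left)
      ultimately show "\<exists>\<delta>. h < \<delta> \<and> \<delta> < \<eta> \<and> gamma \<kappa> \<delta> = g + sigma \<kappa> b \<and> (\<exists>e. \<delta> = \<kappa> * e)"
        using gamma_eq[OF d] multiple[OF d] unfolding g_def by auto
    qed
  qed
qed

end


section \<open>Point multiplicity of Shapirovskii \<open>\<pi>\<close>-bases\<close>

text \<open>Pass to complements in the cover definition. The factor \<open>topspace X\<close> gives
  the empty \<open>J\<close> its intended meaning.\<close>

lemma initially_compact_Inter:
  assumes compact: "initially_compact \<kappa> X" and small: "I \<lesssim> {..<\<kappa>}"
    and closed: "\<And>i. i \<in> I \<Longrightarrow> closedin X (C i)"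
    and fip: "\<And>J. finite J \<Longrightarrow> J \<subseteq> I \<Longrightarrow> topspace X \<inter> (\<Inter>i\<in>J. C i) \<noteq> {}"
  shows "\<exists>x\<in>topspace X. \<forall>i\<in>I. x \<in> C i"
proof (rule ccontr)
  assume "\<not> ?thesis"
  then have "\<Union>((\<lambda>i. topspace X - C i) ` I) = topspace X"
    by blast
  moreover have "(\<lambda>i. topspace X - C i) ` I \<lesssim> {..<\<kappa>}"
    by (rule lepoll_trans[OF image_lepoll small])
  moreover have "\<forall>U\<in>(\<lambda>i. topspace X - C i) ` I. openin X U"
    using closed by auto
  ultimately obtain \<V> where "\<V> \<subseteq> (\<lambda>i. topspace X - C i) ` I" "finite \<V>" "\<Union>\<V> = topspace X"
    using compact unfolding initially_compact_def by meson
  then obtain J where "finite J" "J \<subseteq> I" "(\<Union>i\<in>J. topspace X - C i) = topspace X"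
    by (metis finite_subset_image)
  then show False
    using fip[of J] by blast
qed

text \<open>Transfinite recursion choosing an element of \<open>T\<close> that is
  \<open>R\<close>-above all earlier ones. Each initial segment has at most \<kappa> elements below
  \<open>cardinal_succ \<kappa>\<close>, so \<open>extend\<close> applies there; beyond it the
  choice is arbitrary.\<close>

lemma transfinite_chain:
  fixes \<kappa> :: "'b ordinal"
  assumes \<kappa>: "infinite_cardinal \<kappa>"
    and extend: "\<And>B. B \<subseteq> T \<Longrightarrow> B \<lesssim> {..<\<kappa>} \<Longrightarrow> \<exists>h\<in>T. \<forall>b\<in>B. R b h"
  obtains f where "\<And>\<xi>. \<xi> < cardinal_succ \<kappa> \<Longrightarrow> f \<xi> \<in> T"
    "\<And>\<zeta> \<xi>. \<zeta> < \<xi> \<Longrightarrow> \<xi> < cardinal_succ \<kappa> \<Longrightarrow> R (f \<zeta>) (f \<xi>)"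
proof -
  define f where "f = wfrec {(x :: 'b ordinal, y). x < y} (\<lambda>f \<xi>. SOME h. h \<in> T \<and> (\<forall>\<zeta><\<xi>. R (f \<zeta>) h))"
  have f: "f \<xi> = (SOME h. h \<in> T \<and> (\<forall>\<zeta><\<xi>. R (f \<zeta>) h))" for \<xi>
    unfolding f_def by (subst wfrec) (simp_all add: wf cut_def)
  have *: "f \<xi> \<in> T \<and> (\<forall>\<zeta><\<xi>. R (f \<zeta>) (f \<xi>))" if "\<xi> < cardinal_succ \<kappa>" for \<xi>
    using that
  proof (induction \<xi> rule: less_induct)
    case (less \<xi>)
    have "f ` {..<\<xi>} \<subseteq> T"
      using less by auto
    moreover have "f ` {..<\<xi>} \<lesssim> {..<\<kappa>}"
      by (rule lepoll_trans[OF image_lepoll lessThan_cardinal_succ_lepoll[OF \<kappa> less.prems]])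
    ultimately have "\<exists>h\<in>T. \<forall>b\<in>f ` {..<\<xi>}. R b h"
      by (rule extend)
    then have "\<exists>h. h \<in> T \<and> (\<forall>\<zeta><\<xi>. R (f \<zeta>) h)"
      by auto
    then show ?case
      unfolding f[of \<xi>] by (rule someI_ex)
  qed
  then show thesis
    using that[of f] by blast
qed

theorem theorem2p6:
  fixes X :: "'a topology" and \<kappa> :: "'a set set ordinal"
    and p :: "'a set set ordinal \<Rightarrow> 'a"
    and S :: "'a set set ordinal \<times> 'a set set ordinal \<Rightarrow> 'a set"
  assumes "infinite_cardinal \<kappa>"
    and "regular_space X" and "t1_space X"
    and "initially_compact \<kappa> X"
    and "pi_character X = \<kappa>"
    and "\<nexists>q. free_sequence X (cardinal_succ \<kappa>) q"
    and "shapirovskii_pi_base X p S"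
  shows "point_at_most \<kappa> X S ({..<top_density X} \<times> {..<\<kappa>})"
  unfolding point_at_most_def
proof (intro ballI, rule ccontr)
  fix x
  assume x: "x \<in> topspace X"
    and large: "\<not> {a \<in> {..<top_density X} \<times> {..<\<kappa>}. x \<in> S a} \<lesssim> {..<\<kappa>}"
  define \<mu> :: "'a set set ordinal" where "\<mu> = top_density X"
  let ?P = "\<lambda>\<alpha>. X closure_of (p ` {..<\<alpha>})"
  have inf: "infinite {..<\<kappa>}"
    using assms(1) by (simp add: infinite_cardinal_def)
  have opens: "S ` ({..<\<mu>} \<times> {..<\<kappa>}) \<subseteq> nonempty_opens X"
    and disjoint: "\<forall>\<alpha><\<mu>. ?P \<alpha> \<inter> (\<Union>a \<in> {\<alpha>..<\<mu>} \<times> {..<\<kappa>}. X closure_of S a) = {}"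
    and trace: "\<forall>\<delta> A. 0 < \<delta> \<and> \<delta> \<le> \<mu> \<and> (\<exists>\<epsilon>. \<delta> = \<kappa> * \<epsilon>) \<and>
         finite A \<and> A \<subseteq> {gamma \<kappa> \<delta>..<\<delta>} \<times> {..<\<kappa>} \<and>
         topspace X \<inter> (\<Inter>a\<in>A. X closure_of S a) \<noteq> {} \<longrightarrow>
         topspace X \<inter> (\<Inter>a\<in>A. X closure_of S a) \<inter> (\<Union>\<alpha>\<in>{..<\<delta>}. ?P \<alpha>) \<noteq> {}"
    using assms(7) unfolding shapirovskii_pi_base_def Let_def assms(5) \<mu>_def[symmetric]
    by - (elim conjE, assumption)+
  have closure: "x \<in> X closure_of S a" if "a \<in> {..<\<mu>} \<times> {..<\<kappa>}" "x \<in> S a" for a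
  proof -
    have "openin X (S a)"
      using opens that(1) unfolding nonempty_opens_def by blast
    then have "S a \<subseteq> X closure_of S a"
      by (intro closure_of_subset openin_subset)
    then show ?thesis
      using that(2) by (rule subsetD)
  qed

  \<comment> \<open>The critical ordinal \<eta>\<close>
  define H where "H = {\<alpha>. \<alpha> < \<mu> \<and> (\<exists>i<\<kappa>. x \<in> S (\<alpha>, i))}"
  \<comment> \<open>Each \<alpha> carries at most \<kappa> indices \<open>i\<close>, so a small
    \<open>H\<close> would leave at most \<kappa> pairs.\<close>
  have "\<not> H \<inter> {..<\<mu>} \<lesssim> {..<\<kappa>}"
  proof
    assume "H \<inter> {..<\<mu>} \<lesssim> {..<\<kappa>}"
    then have "(\<Union>\<alpha>\<in>H \<inter> {..<\<mu>}. Pair \<alpha> ` {..<\<kappa>}) \<lesssim> {..<\<kappa>}"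
      by (intro lepoll_infinite_UN[OF inf]) (simp_all add: image_lepoll)
    moreover have "{a \<in> {..<top_density X} \<times> {..<\<kappa>}. x \<in> S a} \<subseteq>
        (\<Union>\<alpha>\<in>H \<inter> {..<\<mu>}. Pair \<alpha> ` {..<\<kappa>})"
      by (auto simp: H_def \<mu>_def)
    ultimately have "{a \<in> {..<top_density X} \<times> {..<\<kappa>}. x \<in> S a} \<lesssim> {..<\<kappa>}"
      by (rule lepoll_trans[OF subset_imp_lepoll, rotated])
    with large show False ..
  qed
  define \<eta> where "\<eta> = (LEAST \<eta>. \<not> H \<inter> {..<\<eta>} \<lesssim> {..<\<kappa>})"
  have \<eta>: "\<not> H \<inter> {..<\<eta>} \<lesssim> {..<\<kappa>}"
    unfolding \<eta>_def by (rule LeastI) (rule \<open>\<not> H \<inter> {..<\<mu>} \<lesssim> {..<\<kappa>}\<close>)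
  have "\<eta> \<le> \<mu>"
    unfolding \<eta>_def by (rule Least_le) (rule \<open>\<not> H \<inter> {..<\<mu>} \<lesssim> {..<\<kappa>}\<close>)
  \<comment> \<open>If no element of \<open>H\<close> below \<eta> lies above \<open>B\<close>, the
    sets \<open>insert b (H \<inter> {..<b})\<close> cover \<open>H \<inter> {..<\<eta>}\<close>;
    each is small by leastness of \<eta>, hence so is their union.\<close>
  have bounded: "\<exists>h\<in>H \<inter> {..<\<eta>}. \<forall>b\<in>B. b < h" if B: "B \<subseteq> {..<\<eta>}" "B \<lesssim> {..<\<kappa>}" for B
  proof (rule ccontr)
    assume unbounded: "\<not> ?thesis"
    have "H \<inter> {..<\<eta>} \<subseteq> (\<Union>b\<in>B. insert b (H \<inter> {..<b}))"
    proof
      fix h assume h: "h \<in> H \<inter> {..<\<eta>}"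
      with unbounded obtain b where "b \<in> B" "\<not> b < h"
        by blast
      then show "h \<in> (\<Union>b\<in>B. insert b (H \<inter> {..<b}))"
        using h by (intro UN_I[of b]) auto
    qed
    moreover have "H \<inter> {..<b} \<lesssim> {..<\<kappa>}" if "b \<in> B" for b
    proof -
      have "b < \<eta>"
        using B(1) that by auto
      then show ?thesis
        unfolding \<eta>_def by (metis (no_types) not_less_Least)
    qed
    then have "(\<Union>b\<in>B. insert b (H \<inter> {..<b})) \<lesssim> {..<\<kappa>}"
      by (intro lepoll_infinite_UN[OF inf] B(2) lepoll_infinite_insert[OF inf])
    ultimately have "H \<inter> {..<\<eta>} \<lesssim> {..<\<kappa>}"
      by (rule lepoll_trans[OF subset_imp_lepoll])
    with \<eta> show False ..
  qed
  have "\<eta> \<noteq> 0"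
    using bounded[of "{}"] by auto
  then obtain g where "g < \<eta>" and cofinal:
    "\<And>h. h < \<eta> \<Longrightarrow> \<exists>\<delta>. h < \<delta> \<and> \<delta> < \<eta> \<and> gamma \<kappa> \<delta> = g \<and> (\<exists>e. \<delta> = \<kappa> * e)"
  proof (rule gamma_constant_cofinally[OF assms(1)])
    fix B assume "B \<subseteq> {..<\<eta>}" "B \<lesssim> {..<\<kappa>}"
    then have "\<exists>h\<in>H \<inter> {..<\<eta>}. \<forall>b\<in>B. b < h"
      by (rule bounded)
    then show "\<exists>h<\<eta>. \<forall>b\<in>B. b < h"
      by auto
  qed (rule that)
  then obtain D where D: "\<And>h. h < \<eta> \<Longrightarrow>
      h < D h \<and> D h < \<eta> \<and> gamma \<kappa> (D h) = g \<and> (\<exists>e. D h = \<kappa> * e)"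
    by metis
  have "\<forall>h\<in>H. \<exists>i. i < \<kappa> \<and> x \<in> S (h, i)"
    unfolding H_def by blast
  then obtain I where I: "\<And>h. h \<in> H \<Longrightarrow> I h < \<kappa> \<and> x \<in> S (h, I h)"
    by (metis (no_types))

  \<comment> \<open>The interleaved sequences \<open>t\<close> and
    \<open>D (t \<xi>)\<close>\<close>
  define T where "T = H \<inter> {g..<\<eta>}"
  obtain t where t: "\<And>\<xi>. \<xi> < cardinal_succ \<kappa> \<Longrightarrow> t \<xi> \<in> T"
    and t_less: "\<And>\<zeta> \<xi>. \<zeta> < \<xi> \<Longrightarrow> \<xi> < cardinal_succ \<kappa> \<Longrightarrow> D (t \<zeta>) < t \<xi>"
  proof (rule transfinite_chain[OF assms(1), of T "\<lambda>b h. D b < h"])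
    fix B assume B: "B \<subseteq> T" "B \<lesssim> {..<\<kappa>}"
    \<comment> \<open>Including \<open>g\<close> forces the new element into the tail
      \<open>T\<close>. All chosen indices are then at least
      \<open>g = gamma \<kappa> (D h)\<close>, as condition (c) requires.\<close>
    have "insert g (D ` B) \<lesssim> {..<\<kappa>}"
      by (rule lepoll_infinite_insert[OF inf lepoll_trans[OF image_lepoll B(2)]])
    moreover have "insert g (D ` B) \<subseteq> {..<\<eta>}"
      using B(1) D \<open>g < \<eta>\<close> unfolding T_def by auto
    ultimately obtain h where "h \<in> H \<inter> {..<\<eta>}" "\<forall>b\<in>insert g (D ` B). b < h"
      using bounded by meson
    then show "\<exists>h\<in>T. \<forall>b\<in>B. D b < h"
      unfolding T_def by (intro bexI[of _ h]) auto
  qed (rule that)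
  let ?a = "\<lambda>\<xi>. (t \<xi>, I (t \<xi>))"
  have a: "?a \<xi> \<in> {g..<\<eta>} \<times> {..<\<kappa>}" "x \<in> S (?a \<xi>)" if "\<xi> < cardinal_succ \<kappa>" for \<xi>
    using t[OF that] I[of "t \<xi>"] unfolding T_def by auto

  have "\<exists>q. q \<in> ?P (D (t \<xi>)) \<and> (\<forall>\<zeta>\<le>\<xi>. q \<in> X closure_of S (?a \<zeta>))"
    if \<xi>: "\<xi> < cardinal_succ \<kappa>" for \<xi>
  proof -
    let ?\<delta> = "D (t \<xi>)"
    have \<delta>: "t \<xi> < ?\<delta>" "?\<delta> < \<eta>" "gamma \<kappa> ?\<delta> = g" "\<exists>e. ?\<delta> = \<kappa> * e"
      using D[of "t \<xi>"] a(1)[OF \<xi>] by auto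
    have "{..\<xi>} = insert \<xi> {..<\<xi>}"
      by auto
    then have small: "{..\<xi>} \<lesssim> {..<\<kappa>}"
      using lepoll_infinite_insert[OF inf lessThan_cardinal_succ_lepoll[OF assms(1) \<xi>]] by simp
    have below: "?a \<zeta> \<in> {gamma \<kappa> ?\<delta>..<?\<delta>} \<times> {..<\<kappa>}" if "\<zeta> \<le> \<xi>" for \<zeta>
    proof -
      have "\<zeta> < cardinal_succ \<kappa>"
        using that \<xi> by simp
      moreover have "t \<zeta> \<le> t \<xi>"
      proof (cases "\<zeta> = \<xi>")
        case False
        then have "D (t \<zeta>) < t \<xi>"
          using that \<xi> by (intro t_less) simp_all
        moreover have "t \<zeta> < D (t \<zeta>)"
          using D[of "t \<zeta>"] a(1)[OF \<open>\<zeta> < cardinal_succ \<kappa>\<close>] by simp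
        ultimately show ?thesis
          by simp
      qed simp
      ultimately show ?thesis
        using a(1) \<delta> by fastforce
    qed
    \<comment> \<open>The index \<xi> itself is included: it brings in the factor
      \<open>?P ?\<delta>\<close> and later puts \<open>q \<delta>\<close> on the right side of the
      cut at \<delta>.\<close>
    have "\<exists>q\<in>topspace X. \<forall>\<zeta>\<in>{..\<xi>}. q \<in> X closure_of S (?a \<zeta>) \<inter> ?P ?\<delta>"
    proof (rule initially_compact_Inter[OF assms(4) small])
      fix \<zeta>
      show "closedin X (X closure_of S (?a \<zeta>) \<inter> ?P ?\<delta>)"
        by (intro closedin_Int closedin_closure_of)
    next
      fix J assume J: "finite J" "J \<subseteq> {..\<xi>}"
      have "x \<in> X closure_of S (?a \<zeta>)" if "\<zeta> \<in> J" for \<zeta>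
      proof -
        have "\<zeta> < cardinal_succ \<kappa>"
          using that J(2) \<xi> by auto
        then show ?thesis
          using a \<open>\<eta> \<le> \<mu>\<close> by (intro closure) fastforce+
      qed
      \<comment> \<open>The point \<open>x\<close> witnesses the hypothesis of (c), which then
        supplies a common point in the closure of an initial segment of \<open>p\<close>.\<close>
      then have "topspace X \<inter> (\<Inter>b\<in>?a ` J. X closure_of S b) \<noteq> {}"
        using x by blast
      moreover have "?a ` J \<subseteq> {gamma \<kappa> ?\<delta>..<?\<delta>} \<times> {..<\<kappa>}"
        using below J(2) by blast
      moreover have "0 < ?\<delta>" "?\<delta> \<le> \<mu>"
        using \<delta>(1,2) \<open>\<eta> \<le> \<mu>\<close> by (auto simp: ordinal_zero_less_iff)
      ultimately have "topspace X \<inter> (\<Inter>b\<in>?a ` J. X closure_of S b) \<inter> (\<Union>\<alpha>\<in>{..<?\<delta>}. ?P \<alpha>) \<noteq> {}"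
        using \<delta>(4) J(1) by (intro trace[rule_format] conjI) simp_all
      moreover have "(\<Union>\<alpha>\<in>{..<?\<delta>}. ?P \<alpha>) \<subseteq> ?P ?\<delta>"
        by (intro UN_least closure_of_mono image_mono) auto
      ultimately show "topspace X \<inter> (\<Inter>\<zeta>\<in>J. X closure_of S (?a \<zeta>) \<inter> ?P ?\<delta>) \<noteq> {}"
        by blast
    qed
    then show ?thesis
      by blast
  qed
  then obtain q where q: "\<And>\<xi>. \<xi> < cardinal_succ \<kappa> \<Longrightarrow> q \<xi> \<in> ?P (D (t \<xi>))"
    and q_closure: "\<And>\<xi> \<zeta>. \<xi> < cardinal_succ \<kappa> \<Longrightarrow> \<zeta> \<le> \<xi> \<Longrightarrow> q \<xi> \<in> X closure_of S (?a \<zeta>)"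
    by metis

  \<comment> \<open>Freeness of \<open>q\<close>\<close>
  have "free_sequence X (cardinal_succ \<kappa>) q"
    unfolding free_sequence_def
  proof (intro conjI allI impI)
    show "q ` {..<cardinal_succ \<kappa>} \<subseteq> topspace X"
    proof (rule image_subsetI)
      fix \<xi> assume "\<xi> \<in> {..<cardinal_succ \<kappa>}"
      then show "q \<xi> \<in> topspace X"
        using q[of \<xi>] by (auto dest: in_closure_of[THEN iffD1])
    qed
  next
    fix \<delta> assume \<delta>: "\<delta> < cardinal_succ \<kappa>"
    \<comment> \<open>The cut is made at \<open>t \<delta>\<close>: earlier points lie in
      \<open>?P (t \<delta>)\<close> since \<open>D (t \<xi>) < t \<delta>\<close>, later ones in
      the closure of \<open>S (?a \<delta>)\<close>, and (b) at \<open>t \<delta>\<close> separates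
      the two closed sets.\<close>
    have "X closure_of (q ` {..<\<delta>}) \<subseteq> ?P (t \<delta>)"
    proof (intro closure_of_minimal closedin_closure_of image_subsetI)
      fix \<xi> assume "\<xi> \<in> {..<\<delta>}"
      then have "?P (D (t \<xi>)) \<subseteq> ?P (t \<delta>)" "q \<xi> \<in> ?P (D (t \<xi>))"
        using t_less[of \<xi> \<delta>] \<delta> q[of \<xi>] by (auto intro!: closure_of_mono image_mono)
      then show "q \<xi> \<in> ?P (t \<delta>)"
        by blast
    qed
    moreover have "X closure_of (q ` {\<delta>..<cardinal_succ \<kappa>}) \<subseteq> X closure_of S (?a \<delta>)"
      using q_closure by (intro closure_of_minimal closedin_closure_of image_subsetI) simp
    moreover have "?P (t \<delta>) \<inter> X closure_of S (?a \<delta>) = {}"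
    proof -
      have "t \<delta> < \<mu>" "?a \<delta> \<in> {t \<delta>..<\<mu>} \<times> {..<\<kappa>}"
        using a(1)[OF \<delta>] \<open>\<eta> \<le> \<mu>\<close> by auto
      then show ?thesis
        using disjoint by blast
    qed
    ultimately show "X closure_of (q ` {..<\<delta>}) \<inter> X closure_of (q ` {\<delta>..<cardinal_succ \<kappa>}) = {}"
      by blast
  qed
  with assms(6) show False
    by blast
qed

end
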